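(* Let $N=5$, let $\Gamma_1,\dots,\Gamma_5$ be nonzero real vorticities, and let $\Lambda\in\mathbb{C}$ with $|\Lambda|=1$. Then, up to a permutation of the five vertices and/or the exchange of the two colors $z\leftrightarrow w$, the two-colored diagram of any singular sequence is one of the following thirty-one diagrams. Each diagram is described by the set $E_z$ of $z$-strokes, the set $E_w$ of $w$-strokes, the set $C_z$ of $z$-circled vertices and the set $C_w$ of $w$-circled vertices. Here $ij$ denotes the unordered pair $\{i,j\}$, $K(A)$ denotes the set of all pairs of distinct elements of $A$ (we write $K(abc)$ for $K(\{a,b,c\})$, etc.), and $V=\{1,2,3,4,5\}$. (1) $E_z=\{12\}$, $E_w=\{34\}$, $C_z=\{1,2\}$, $C_w=\{3,4\}$. (2)-(4) $E_z=\{12\}$, $E_w=K(345)$, $C_z=\{1,2\}$, with respectively $C_w=\emptyset$; $C_w=\{3,4\}$; $C_w=\{3,4,5\}$. (5) $E_z=\{12,34\}$, $E_w=\{14,23\}$, $C_z=C_w=\{1,2,3,4\}$. (6) $E_z=E_w=K(123)$, $C_z=C_w=\emptyset$. (7) $E_z=K(123)\cup\{45\}$, $E_w=K(123)$, $C_z=\{4,5\}$, $C_w=\emptyset$. (8) $E_z=E_w=K(123)\cup\{45\}$, $C_z=C_w=V$. (9) $E_z=K(134)$, $E_w=K(124)$, $C_z=C_w=\emptyset$. (10) $E_z=K(134)\cup\{25\}$, $E_w=K(124)$, $C_z=V$, $C_w=\emptyset$. (11) $E_z=K(134)\cup\{25\}$, $E_w=K(124)\cup\{35\}$, $C_z=C_w=V$.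 (12)-(14) $E_z=K(145)$, $E_w=K(123)$, with respectively $C_z=C_w=\emptyset$; $C_z=\emptyset,\ C_w=\{2,3\}$; $C_z=\{4,5\},\ C_w=\{2,3\}$. (15) $E_z=K(145)\cup\{23\}$, $E_w=K(123)\cup\{45\}$, $C_z=C_w=V$. (16) $E_z=K(1234)$, $E_w=K(123)$, $C_z=\{1,2,3,4\}$, $C_w=\emptyset$. (17) $E_z=K(1234)$, $E_w=K(123)\cup\{45\}$, $C_z=\{1,2,3\}$, $C_w=V$. (18)-(19) $E_z=K(135)$, $E_w=K(1234)$, $C_z=\emptyset$, with respectively $C_w=\emptyset$; $C_w=\{2,4\}$. (20) $E_z=K(135)\cup\{24\}$, $E_w=K(1234)$, $C_z=V$, $C_w=\emptyset$. (21) $E_z=E_w=K(1234)$, $C_z=C_w=\emptyset$. (22)-(25) $E_z=K(V)$, $E_w=K(123)$, $C_w=\emptyset$, with respectively $C_z=\{1,2,3,4\}$; $C_z=V$; $C_z=\emptyset$; $C_z=\{4,5\}$. (26)-(27) $E_z=K(V)$, $E_w=K(123)\cup\{45\}$, $C_w=V$, with respectively $C_z=\{1,2,3\}$; $C_z=V$. (28) $E_z=K(1234)$, $E_w=K(1235)$, $C_z=C_w=\emptyset$. (29) $E_z=K(V)$, $E_w=K(1234)$, $C_z=V$, $C_w=\emptyset$. (30)-(31) $E_z=E_w=K(V)$, with respectively $C_z=C_w=\emptyset$; $C_z=C_w=V$.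
   Context: Fix $N$, nonzero real vorticities $\Gamma_1,\dots,\Gamma_N$, and $\Lambda\in\mathbb{C}$ with $|\Lambda|=1$. Consider the following system in the unknowns $z_n,w_n\in\mathbb{C}$ ($1\le n\le N$) and $Z_{jk},W_{jk}\in\mathbb{C}$ ($1\le j<k\le N$), with $z_{jk}=z_k-z_j$, $w_{jk}=w_k-w_j$, $Z_{kj}=-Z_{jk}$, $W_{kj}=-W_{jk}$: $$\Lambda z_n=\sum_{j\ne n}\Gamma_jZ_{jn},\qquad \overline{\Lambda}w_n=\sum_{j\ne n}\Gamma_jW_{jn},\qquad Z_{jk}w_{jk}=1,\qquad W_{jk}z_{jk}=1 .$$ Put $\mathcal{Z}=(z_1,\dots,z_N,Z_{12},Z_{13},\dots,Z_{(N-1)N})$ and $\mathcal{W}=(w_1,\dots,w_N,W_{12},W_{13},\dots,W_{(N-1)N})$, and let $\|\cdot\|$ be the maximum modulus of the components. Solutions are normalized by $\|\mathcal{Z}\|=\|\mathcal{W}\|$ (possible because $(\mathcal Z,\mathcal W)\mapsto(a\mathcal Z,a^{-1}\mathcal W)$, $a\in\mathbb{C}\setminus\{0\}$, preserves the system). A singular sequence is a sequence of such normalized solutions $(\mathcal{Z}^{(n)},\mathcal{W}^{(n)})$ with $\|\mathcal{Z}^{(n)}\|=\|\mathcal{W}^{(n)}\|\to\infty$, extracted so that the index of a component of maximal modulus of $\mathcal{Z}^{(n)}$ (and of $\mathcal{W}^{(n)}$) is independent of $n$, and so that $\mathcal{Z}^{(n)}/\|\mathcal{Z}^{(n)}\|$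 and $\mathcal{W}^{(n)}/\|\mathcal{W}^{(n)}\|$ converge. Define $\epsilon>0$ (depending on $n$) by $\|\mathcal{Z}^{(n)}\|=\|\mathcal{W}^{(n)}\|=\epsilon^{-2}$, so $\epsilon\to0$. For sequences $a,b$, write $a\approx b$ if both $a/b$ and $b/a$ are bounded. Two-colored diagram of a singular sequence: the vertices are $1,\dots,N$. Vertex $k$ is $z$-circled if $z_k\approx\epsilon^{-2}$, and there is a $z$-stroke between $j$ and $k$ if $Z_{jk}\approx\epsilon^{-2}$. Vertex $k$ is $w$-circled if $w_k\approx\epsilon^{-2}$, and there is a $w$-stroke between $j$ and $k$ if $W_{jk}\approx\epsilon^{-2}$. The two-colored diagram records all $z$-strokes, $w$-strokes, $z$-circles and $w$-circles. *)

theory Defs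
  imports Complex_Main "HOL-Combinatorics.Permutations"
begin

text \<open>The components of the vectors \<open>(z\<^sub>1, \<dots>, z\<^sub>N, Z\<^sub>1\<^sub>2, \<dots>)\<close> and
  \<open>(w\<^sub>1, \<dots>, w\<^sub>N, W\<^sub>1\<^sub>2, \<dots>)\<close>. Only \<open>Sep j k\<close> with \<open>j < k\<close> is an unknown; \<open>sep\<close> below
  extends it antisymmetrically. Values outside \<open>indices N\<close> play no role.\<close>

datatype component = Vert nat | Sep nat nat

type_synonym cvector = "component \<Rightarrow> complex"

definition indices :: "nat \<Rightarrow> component set" where
  "indices N = Vert ` {1..N} \<union> {Sep j k | j k. 1 \<le> j \<and> j < k \<and> k \<le> N}"

definition pos :: "cvector \<Rightarrow> nat \<Rightarrow> complex" where
  "pos X n = X (Vert n)"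

definition sep :: "cvector \<Rightarrow> nat \<Rightarrow> nat \<Rightarrow> complex" where
  "sep X j k = (if j < k then X (Sep j k) else - X (Sep k j))"

definition max_norm :: "nat \<Rightarrow> cvector \<Rightarrow> real" where
  "max_norm N X = Max ((\<lambda>i. cmod (X i)) ` indices N)"

definition is_solution :: "nat \<Rightarrow> (nat \<Rightarrow> real) \<Rightarrow> complex \<Rightarrow> cvector \<Rightarrow> cvector \<Rightarrow> bool" where
  "is_solution N \<Gamma> \<Lambda> X Y \<longleftrightarrow>
     (\<forall>n\<in>{1..N}. \<Lambda> * pos X n = (\<Sum>j\<in>{1..N} - {n}. of_real (\<Gamma> j) * sep X j n)) \<and>
     (\<forall>n\<in>{1..N}. cnj \<Lambda> * pos Y n = (\<Sum>j\<in>{1..N} - {n}. of_real (\<Gamma> j) * sep Y j n)) \<and>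
     (\<forall>j k. 1 \<le> j \<and> j < k \<and> k \<le> N \<longrightarrow>
        sep X j k * (pos Y k - pos Y j) = 1 \<and>
        sep Y j k * (pos X k - pos X j) = 1)"

definition singular_sequence ::
  "nat \<Rightarrow> (nat \<Rightarrow> real) \<Rightarrow> complex \<Rightarrow> (nat \<Rightarrow> cvector) \<Rightarrow> (nat \<Rightarrow> cvector) \<Rightarrow> bool" where
  "singular_sequence N \<Gamma> \<Lambda> X Y \<longleftrightarrow>
     (\<forall>n. is_solution N \<Gamma> \<Lambda> (X n) (Y n)) \<and>
     (\<forall>n. max_norm N (X n) = max_norm N (Y n)) \<and>
     filterlim (\<lambda>n. max_norm N (X n)) at_top sequentially \<and>
     (\<exists>i\<in>indices N. \<forall>n. cmod (X n i) = max_norm N (X n)) \<and>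
     (\<exists>i\<in>indices N. \<forall>n. cmod (Y n i) = max_norm N (Y n)) \<and>
     (\<forall>i\<in>indices N. convergent (\<lambda>n. X n i / of_real (max_norm N (X n)))) \<and>
     (\<forall>i\<in>indices N. convergent (\<lambda>n. Y n i / of_real (max_norm N (Y n))))"

text \<open>The positive solution \<open>\<epsilon>\<close> of \<open>max_norm N X = \<epsilon>\<^sup>-\<^sup>2\<close>.\<close>

definition eps :: "nat \<Rightarrow> cvector \<Rightarrow> real" where
  "eps N X = 1 / sqrt (max_norm N X)"

text \<open>Both quotients are bounded. Since \<open>x / 0 = 0\<close> in HOL, the sequences must be required to be
  eventually nonzero: otherwise the zero sequence would be comparable to every sequence.\<close>

definition comparable :: "(nat \<Rightarrow> complex) \<Rightarrow> (nat \<Rightarrow> complex) \<Rightarrow> bool"  where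
  "comparable a b \<longleftrightarrow>
     (\<forall>\<^sub>F n in sequentially. a n \<noteq> 0 \<and> b n \<noteq> 0) \<and>
     Bseq (\<lambda>n. a n / b n) \<and> Bseq (\<lambda>n. b n / a n)"

datatype diagram =
  Diagram (z_strokes: "nat set set") (w_strokes: "nat set set")
          (z_circles: "nat set") (w_circles: "nat set")

text \<open>In both functions \<open>e\<close> is the sequence \<open>\<epsilon>\<close> of the singular sequence from which \<open>X\<close> comes.\<close>

definition strokes :: "nat \<Rightarrow> (nat \<Rightarrow> real) \<Rightarrow> (nat \<Rightarrow> cvector) \<Rightarrow> nat set set" where
  "strokes N e X = {{j, k} | j k. 1 \<le> j \<and> j < k \<and> k \<le> N \<and>
     comparable (\<lambda>n. sep (X n) j k) (\<lambda>n. of_real (e n powi -2))}"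

definition circles :: "nat \<Rightarrow> (nat \<Rightarrow> real) \<Rightarrow> (nat \<Rightarrow> cvector) \<Rightarrow> nat set" where
  "circles N e X = {k \<in> {1..N}. comparable (\<lambda>n. pos (X n) k) (\<lambda>n. of_real (e n powi -2))}"

definition diagram_of :: "nat \<Rightarrow> (nat \<Rightarrow> cvector) \<Rightarrow> (nat \<Rightarrow> cvector) \<Rightarrow> diagram" where
  "diagram_of N X Y = (let e = (\<lambda>n. eps N (X n)) in
     Diagram (strokes N e X) (strokes N e Y) (circles N e X) (circles N e Y))"

primrec exchange_colors :: "diagram \<Rightarrow> diagram" where
  "exchange_colors (Diagram Ez Ew Cz Cw) = Diagram Ew Ez Cw Cz"

primrec relabel :: "(nat \<Rightarrow> nat) \<Rightarrow> diagram \<Rightarrow> diagram" where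
  "relabel p (Diagram Ez Ew Cz Cw) = Diagram ((`) p ` Ez) ((`) p ` Ew) (p ` Cz) (p ` Cw)"

definition equivalent_diagrams :: "nat \<Rightarrow> diagram \<Rightarrow> diagram \<Rightarrow> bool" where
  "equivalent_diagrams N D D' \<longleftrightarrow>
     (\<exists>p. p permutes {1..N} \<and> (D = relabel p D' \<or> D = relabel p (exchange_colors D')))"

definition K :: "nat set \<Rightarrow> nat set set" where
  "K A = {{i, j} | i j. i \<in> A \<and> j \<in> A \<and> i \<noteq> j}"

abbreviation V5 :: "nat set" where
  "V5 \<equiv> {1, 2, 3, 4, 5}"

definition five_vortex_diagrams :: "diagram list" where
  "five_vortex_diagrams =
    [ Diagram {{1,2}} {{3,4}} {1,2} {3,4},
      Diagram {{1,2}} (K {3,4,5}) {1,2} {},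
      Diagram {{1,2}} (K {3,4,5}) {1,2} {3,4},
      Diagram {{1,2}} (K {3,4,5}) {1,2} {3,4,5},
      Diagram {{1,2},{3,4}} {{1,4},{2,3}} {1,2,3,4} {1,2,3,4},
      Diagram (K {1,2,3}) (K {1,2,3}) {} {},
      Diagram (K {1,2,3} \<union> {{4,5}}) (K {1,2,3}) {4,5} {},
      Diagram (K {1,2,3} \<union> {{4,5}}) (K {1,2,3} \<union> {{4,5}}) V5 V5,
      Diagram (K {1,3,4}) (K {1,2,4}) {} {},
      Diagram (K {1,3,4} \<union> {{2,5}}) (K {1,2,4}) V5 {},
      Diagram (K {1,3,4} \<union> {{2,5}}) (K {1,2,4} \<union> {{3,5}}) V5 V5,
      Diagram (K {1,4,5}) (K {1,2,3}) {} {},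
      Diagram (K {1,4,5}) (K {1,2,3}) {} {2,3},
      Diagram (K {1,4,5}) (K {1,2,3}) {4,5} {2,3},
      Diagram (K {1,4,5} \<union> {{2,3}}) (K {1,2,3} \<union> {{4,5}}) V5 V5,
      Diagram (K {1,2,3,4}) (K {1,2,3}) {1,2,3,4} {},
      Diagram (K {1,2,3,4}) (K {1,2,3} \<union> {{4,5}}) {1,2,3} V5,
      Diagram (K {1,3,5}) (K {1,2,3,4}) {} {},
      Diagram (K {1,3,5}) (K {1,2,3,4}) {} {2,4},
      Diagram (K {1,3,5} \<union> {{2,4}}) (K {1,2,3,4}) V5 {},
      Diagram (K {1,2,3,4}) (K {1,2,3,4}) {} {},
      Diagram (K V5) (K {1,2,3}) {1,2,3,4} {},
      Diagram (K V5) (K {1,2,3}) V5 {},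
      Diagram (K V5) (K {1,2,3}) {} {},
      Diagram (K V5) (K {1,2,3}) {4,5} {},
      Diagram (K V5) (K {1,2,3} \<union> {{4,5}}) {1,2,3} V5,
      Diagram (K V5) (K {1,2,3} \<union> {{4,5}}) V5 V5,
      Diagram (K {1,2,3,4}) (K {1,2,3,5}) {} {},
      Diagram (K V5) (K {1,2,3,4}) V5 {},
      Diagram (K V5) (K V5) {} {},
      Diagram (K V5) (K V5) V5 V5 ]"

end

theory Submission
  imports Defs
begin

text \<open>Let \<open>s\<close> be the common norm of the two vectors of a singular sequence and divide everything by \<open>s\<close>.
  In the limit there are positions \<open>\<zeta>\<close>, \<open>\<omega>\<close> and separations \<open>\<sigma>\<close>, \<open>\<tau>\<close> of the two colours. A
  vertex is circled iff its limiting position is nonzero, and two vertices are joined by a stroke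
  iff their limiting separation is nonzero (\<open>diagram_eq\<close>).

  A \<open>z\<close>-stroke \<open>jk\<close> means that \<open>s (w\<^sub>k - w\<^sub>j)\<close> converges, with limit \<open>1 / \<sigma>\<^sub>j\<^sub>k\<close>. Such limits add up along
  consecutive strokes, so the \<open>z\<close>-strokes form disjoint cliques and \<open>\<omega>\<close> is constant on every
  \<open>z\<close>-clique. A diagram is thus a pair of partitions of the vertices together with two sets of
  circles, where each set of circles is a union of cliques of the other colour.

  Three identities restrict the vorticities. For a \<open>z\<close>-clique \<open>A\<close> with base point \<open>a\<close>, summing the
  limiting equations over \<open>A\<close>, without and with the weights \<open>v\<^sub>k = lim s (w\<^sub>k - w\<^sub>a)\<close>, gives
  \<open>\<Sum>\<^sub>A \<Gamma>\<^sub>k \<zeta>\<^sub>k = 0\<close> (\<open>clique_moment\<close>) and \<open>2 \<Lambda> \<Sum>\<^sub>A \<Gamma>\<^sub>k \<zeta>\<^sub>k v\<^sub>k = (\<Sum>\<^sub>A \<Gamma>\<^sub>k)\<^sup>2 - \<Sum>\<^sub>A \<Gamma>\<^sub>k\<^sup>2\<close> (\<open>clique_virial\<close>).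
  The third one concerns all vertices \<open>T\<close> with one and the same value of \<open>\<zeta>\<close>: if their vorticities
  sum to zero, then \<open>s \<Sum>\<^sub>T \<Gamma>\<^sub>k w\<^sub>k \<rightarrow> 0\<close> (\<open>cluster_moment\<close>), because seen from outside the vertices of
  \<open>T\<close> act like a single vortex of strength zero.

  Since \<open>\<Gamma>\<close> is real and nonzero, the right-hand side of the second identity is negative as soon as
  \<open>\<Sum>\<^sub>A \<Gamma>\<^sub>k = 0\<close>, while it is zero if \<open>A\<close> is uncircled. Playing these facts off against each other
  yields purely combinatorial conditions on the diagram, \<open>circle_rules\<close> and \<open>vorticity_rules\<close>,
  which hold for any number of vortices. For five vortices it remains to go through the finitely
  many pairs of partitions and unions of cliques: every one that obeys the rules is isomorphic to
  one of the thirty-one diagrams, up to the exchange of colours. This is checked by rewriting,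
  with the first partition brought into one of six normal forms.\<close>

section \<open>Limits at the scale of the norm\<close>

definition limit_pos :: "nat \<Rightarrow> (nat \<Rightarrow> cvector) \<Rightarrow> nat \<Rightarrow> complex" where
  "limit_pos N X k = lim (\<lambda>n. pos (X n) k / of_real (max_norm N (X n)))"

definition limit_sep :: "nat \<Rightarrow> (nat \<Rightarrow> cvector) \<Rightarrow> nat \<Rightarrow> nat \<Rightarrow> complex" where
  "limit_sep N X j k = lim (\<lambda>n. sep (X n) j k / of_real (max_norm N (X n)))"

text \<open>Equality is included so that the relation is reflexive; the diagonal values of
  \<open>limit_sep\<close> carry no information.\<close>

definition same_clique :: "nat \<Rightarrow> (nat \<Rightarrow> cvector) \<Rightarrow> nat \<Rightarrow> nat \<Rightarrow> bool" where
  "same_clique N X j k \<longleftrightarrow> j = k \<or> limit_sep N X j k \<noteq> 0"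

lemma sum_antisymmetric_eq_0:
  fixes g :: "'a \<Rightarrow> 'a \<Rightarrow> complex"
  assumes "finite A" and anti: "\<And>i j. \<lbrakk>i \<in> A; j \<in> A; i \<noteq> j\<rbrakk> \<Longrightarrow> g i j = - g j i"
  shows "(\<Sum>i\<in>A. \<Sum>j\<in>A - {i}. g i j) = 0"
proof -
  define h where "h i j = (if i = j then 0 else g i j)" for i j
  have eq: "(\<Sum>i\<in>A. \<Sum>j\<in>A - {i}. g i j) = (\<Sum>i\<in>A. \<Sum>j\<in>A. h i j)"
  proof (rule sum.cong[OF refl])
    fix i assume "i \<in> A"
    then have "(\<Sum>j\<in>A. h i j) = h i i + (\<Sum>j\<in>A - {i}. h i j)"
      using \<open>finite A\<close> by (simp add: sum.remove)
    moreover have "(\<Sum>j\<in>A - {i}. h i j) = (\<Sum>j\<in>A - {i}. g i j)"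
      by (rule sum.cong) (auto simp: h_def)
    moreover have "h i i = 0" by (simp add: h_def)
    ultimately show "(\<Sum>j\<in>A - {i}. g i j) = (\<Sum>j\<in>A. h i j)" by simp
  qed
  have "(\<Sum>i\<in>A. \<Sum>j\<in>A. h i j) = (\<Sum>i\<in>A. \<Sum>j\<in>A. h j i)" by (rule sum.swap)
  also have "\<dots> = (\<Sum>i\<in>A. \<Sum>j\<in>A. - h i j)"
  proof (intro sum.cong refl)
    fix i j assume "i \<in> A" "j \<in> A"
    then show "h j i = - h i j" using anti[of j i] by (cases "i = j") (simp_all add: h_def)
  qed
  also have "\<dots> = - (\<Sum>i\<in>A. \<Sum>j\<in>A. h i j)" by (simp add: sum_negf)
  finally show ?thesis unfolding eq by simp
qed

text \<open>Interactions inside \<open>T\<close> cancel by antisymmetry (action equals reaction); only those with vertices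
  outside \<open>T\<close> remain. This is the source of both moment identities below.\<close>

lemma weighted_interaction_sum:
  fixes g :: "nat \<Rightarrow> complex" and s :: "nat \<Rightarrow> nat \<Rightarrow> complex"
  assumes "finite V" "T \<subseteq> V"
    and anti: "\<And>j k. \<lbrakk>j \<in> V; k \<in> V; j \<noteq> k\<rbrakk> \<Longrightarrow> s k j = - s j k"
  shows "(\<Sum>k\<in>T. g k * (\<Sum>j\<in>V - {k}. g j * s j k)) = (\<Sum>k\<in>T. \<Sum>j\<in>V - T. g k * g j * s j k)"
proof -
  have fin: "finite T" using assms finite_subset by blast
  have "g k * (\<Sum>j\<in>V - {k}. g j * s j k) =
      (\<Sum>j\<in>T - {k}. g k * g j * s j k) + (\<Sum>j\<in>V - T. g k * g j * s j k)" if "k \<in> T" for k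
  proof -
    have "V - {k} = (T - {k}) \<union> (V - T)" using that assms by auto
    then have "(\<Sum>j\<in>V - {k}. g j * s j k) = (\<Sum>j\<in>T - {k}. g j * s j k) + (\<Sum>j\<in>V - T. g j * s j k)"
      using assms fin by (simp only:) (rule sum.union_disjoint, auto)
    then show ?thesis by (simp add: distrib_left sum_distrib_left mult.assoc)
  qed
  then have "(\<Sum>k\<in>T. g k * (\<Sum>j\<in>V - {k}. g j * s j k)) =
      (\<Sum>k\<in>T. \<Sum>j\<in>T - {k}. g k * g j * s j k) + (\<Sum>k\<in>T. \<Sum>j\<in>V - T. g k * g j * s j k)"
    by (simp add: sum.distrib)
  moreover have "(\<Sum>k\<in>T. \<Sum>j\<in>T - {k}. g k * g j * s j k) = 0"
  proof (rule sum_antisymmetric_eq_0[OF fin])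
    fix i j assume "i \<in> T" "j \<in> T" "i \<noteq> j"
    then have "s j i = - s i j" using anti[of i j] \<open>T \<subseteq> V\<close> by blast
    then show "g i * g j * s j i = - (g j * g i * s i j)" by simp
  qed
  ultimately show ?thesis by simp
qed

lemma sum_offdiagonal_products:
  fixes g :: "'a \<Rightarrow> complex"
  assumes "finite A"
  shows "(\<Sum>k\<in>A. \<Sum>j\<in>A - {k}. g k * g j) = (\<Sum>k\<in>A. g k)\<^sup>2 - (\<Sum>k\<in>A. (g k)\<^sup>2)"
proof -
  have "(\<Sum>k\<in>A. \<Sum>j\<in>A - {k}. g k * g j) = (\<Sum>k\<in>A. (\<Sum>j\<in>A. g k * g j) - (g k)\<^sup>2)"
    by (intro sum.cong refl) (use assms in \<open>simp add: sum.remove power2_eq_square\<close>)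
  also have "\<dots> = (\<Sum>k\<in>A. \<Sum>j\<in>A. g k * g j) - (\<Sum>k\<in>A. (g k)\<^sup>2)"
    by (simp add: sum_subtractf)
  finally show ?thesis by (simp add: power2_eq_square sum_product)
qed

locale singular_limits =
  fixes N :: nat and \<Gamma> :: "nat \<Rightarrow> real" and \<Lambda> :: complex and X Y :: "nat \<Rightarrow> cvector"
  assumes vorticity: "\<And>k. k \<in> {1..N} \<Longrightarrow> \<Gamma> k \<noteq> 0"
    and unimodular: "cmod \<Lambda> = 1"
    and singular: "singular_sequence N \<Gamma> \<Lambda> X Y"
begin

abbreviation "V \<equiv> {1..N}"
abbreviation "\<gamma> k \<equiv> complex_of_real (\<Gamma> k)"
abbreviation "scale n \<equiv> complex_of_real (max_norm N (X n))"
abbreviation "\<zeta> \<equiv> limit_pos N X"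
abbreviation "\<omega> \<equiv> limit_pos N Y"
abbreviation "\<sigma> \<equiv> limit_sep N X"
abbreviation "clique a \<equiv> {k \<in> V. same_clique N X a k}"

text \<open>The system is symmetric under the exchange of colours if \<open>\<Lambda>\<close> is conjugated. Every fact about the
  colour \<open>z\<close> is proved once and used for \<open>w\<close> through this interpretation.\<close>

lemma exchanged: "singular_limits N \<Gamma> (cnj \<Lambda>) Y X"
proof
  note parts = singular[unfolded singular_sequence_def]
  have "is_solution N \<Gamma> (cnj \<Lambda>) (Y n) (X n)" for n
    using parts unfolding is_solution_def by auto
  moreover have eq: "(\<lambda>n. max_norm N (X n)) = (\<lambda>n. max_norm N (Y n))"
    using parts by blast
  have "filterlim (\<lambda>n. max_norm N (X n)) at_top sequentially" using parts by blast
  then have "filterlim (\<lambda>n. max_norm N (Y n)) at_top sequentially" unfolding eq .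
  ultimately show "singular_sequence N \<Gamma> (cnj \<Lambda>) Y X"
    unfolding singular_sequence_def using parts by (intro conjI allI) (blast | metis)+
qed (use vorticity unimodular in auto)

lemma same_norm: "max_norm N (Y n) = max_norm N (X n)"
  using singular unfolding singular_sequence_def by simp

lemma \<Lambda>_nonzero: "\<Lambda> \<noteq> 0" using unimodular by auto

lemma scale_at_top: "filterlim (\<lambda>n. max_norm N (X n)) at_top sequentially"
  using singular unfolding singular_sequence_def by blast

lemma scale_positive: "\<forall>\<^sub>F n in sequentially. 0 < max_norm N (X n)"
  using scale_at_top eventually_gt_at_top[of 0] by (auto simp: filterlim_iff)

lemma scale_nonzero: "\<forall>\<^sub>F n in sequentially. scale n \<noteq> 0"
  using scale_positive by eventually_elim auto

lemma inverse_scale: "(\<lambda>n. 1 / scale n) \<longlonglongrightarrow> 0"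
proof -
  have "(\<lambda>n. 1 / max_norm N (X n)) \<longlonglongrightarrow> 0"
    using tendsto_divide_0[OF tendsto_const filterlim_at_top_imp_at_infinity[OF scale_at_top]] by simp
  from tendsto_of_real[OF this, where 'a = complex] show ?thesis by simp
qed

lemma component_converges:
  assumes "i \<in> indices N"
  shows "(\<lambda>n. X n i / scale n) \<longlonglongrightarrow> lim (\<lambda>n. X n i / scale n)"
  using assms singular unfolding singular_sequence_def convergent_LIMSEQ_iff by blast

lemma pos_tendsto:
  assumes "k \<in> V" shows "(\<lambda>n. pos (X n) k / scale n) \<longlonglongrightarrow> \<zeta> k"
  using component_converges[of "Vert k"] assms
  by (auto simp: limit_pos_def pos_def indices_def)

lemma sep_tendsto:
  assumes "j \<in> V" "k \<in> V" "j \<noteq> k"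
  shows "(\<lambda>n. sep (X n) j k / scale n) \<longlonglongrightarrow> \<sigma> j k"
proof (cases "j < k")
  case True
  then have "Sep j k \<in> indices N" using assms by (auto simp: indices_def)
  from component_converges[OF this] True show ?thesis by (simp add: limit_sep_def sep_def)
next
  case False
  then have "Sep k j \<in> indices N" using assms by (auto simp: indices_def)
  from tendsto_minus[OF component_converges[OF this]] False
  have "(\<lambda>n. sep (X n) j k / scale n) \<longlonglongrightarrow> - lim (\<lambda>n. X n (Sep k j) / scale n)"
    by (simp add: sep_def)
  then show ?thesis unfolding limit_sep_def by (simp add: limI)
qed

lemma sep_antisym: "j \<noteq> k \<Longrightarrow> sep U k j = - sep U j k"
  by (auto simp: sep_def)

lemma limit_sep_antisym:
  assumes "j \<in> V" "k \<in> V" "j \<noteq> k" shows "\<sigma> k j = - \<sigma> j k"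
proof -
  have "(\<lambda>n. sep (X n) k j / scale n) \<longlonglongrightarrow> - \<sigma> j k"
    using tendsto_minus[OF sep_tendsto[OF assms]] sep_antisym[OF \<open>j \<noteq> k\<close>] by simp
  then show ?thesis using sep_tendsto[of k j] assms LIMSEQ_unique by blast
qed

lemma equation_z: "k \<in> V \<Longrightarrow> \<Lambda> * pos (X n) k = (\<Sum>j\<in>V - {k}. \<gamma> j * sep (X n) j k)"
  using singular unfolding singular_sequence_def is_solution_def by blast

lemma sep_times_difference:
  assumes "j \<in> V" "k \<in> V" "j \<noteq> k"
  shows "sep (X n) j k * (pos (Y n) k - pos (Y n) j) = 1"
proof -
  have *: "sep (X n) a b * (pos (Y n) b - pos (Y n) a) = 1" if "1 \<le> a" "a < b" "b \<le> N" for a b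
    using that singular unfolding singular_sequence_def is_solution_def by blast
  show ?thesis
  proof (cases "j < k")
    case False
    then show ?thesis using *[of k j] assms sep_antisym[of k j "X n"] by (auto simp: algebra_simps)
  qed (use * assms in auto)
qed

lemma limit_equation:
  assumes "k \<in> V" shows "\<Lambda> * \<zeta> k = (\<Sum>j\<in>V - {k}. \<gamma> j * \<sigma> j k)"
proof (rule LIMSEQ_unique)
  show "(\<lambda>n. \<Lambda> * (pos (X n) k / scale n)) \<longlonglongrightarrow> \<Lambda> * \<zeta> k"
    by (intro tendsto_mult_left pos_tendsto assms)
  have "(\<lambda>n. \<Sum>j\<in>V - {k}. \<gamma> j * (sep (X n) j k / scale n)) \<longlonglongrightarrow> (\<Sum>j\<in>V - {k}. \<gamma> j * \<sigma> j k)"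
    by (intro tendsto_sum tendsto_mult_left sep_tendsto) (use assms in auto)
  moreover have "(\<Sum>j\<in>V - {k}. \<gamma> j * (sep (X n) j k / scale n)) = \<Lambda> * (pos (X n) k / scale n)" for n
    using equation_z[OF assms, of n] by (simp add: sum_divide_distrib)
  ultimately show "(\<lambda>n. \<Lambda> * (pos (X n) k / scale n)) \<longlonglongrightarrow> (\<Sum>j\<in>V - {k}. \<gamma> j * \<sigma> j k)" by simp
qed

text \<open>Since the separation is the reciprocal of the gap of the other colour, a stroke means that this gap
  is of order exactly one over the scale.\<close>

lemma rescaled_gap_limit:
  assumes "j \<in> V" "k \<in> V" "j \<noteq> k" "\<sigma> j k \<noteq> 0"
  shows "(\<lambda>n. scale n * (pos (Y n) k - pos (Y n) j)) \<longlonglongrightarrow> 1 / \<sigma> j k"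
proof -
  have "pos (Y n) k - pos (Y n) j = 1 / sep (X n) j k" for n
    using sep_times_difference[OF assms(1-3), of n]
    by (metis nonzero_mult_div_cancel_left mult_zero_left zero_neq_one)
  then have "scale n * (pos (Y n) k - pos (Y n) j) = 1 / (sep (X n) j k / scale n)" for n by simp
  moreover have "(\<lambda>n. 1 / (sep (X n) j k / scale n)) \<longlonglongrightarrow> 1 / \<sigma> j k"
    by (intro tendsto_divide tendsto_const sep_tendsto assms)
  ultimately show ?thesis by (simp only:)
qed

lemma limit_sep_times_gap:
  assumes "j \<in> V" "k \<in> V" "j \<noteq> k"
    and "(\<lambda>n. scale n * (pos (Y n) k - pos (Y n) j)) \<longlonglongrightarrow> u"
  shows "\<sigma> j k * u = 1"
proof -
  have "(\<lambda>n. sep (X n) j k / scale n * (scale n * (pos (Y n) k - pos (Y n) j))) \<longlonglongrightarrow> \<sigma> j k * u"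
    by (intro tendsto_mult sep_tendsto assms)
  moreover have "\<forall>\<^sub>F n in sequentially.
      sep (X n) j k / scale n * (scale n * (pos (Y n) k - pos (Y n) j)) = 1"
    using scale_nonzero by eventually_elim (use sep_times_difference[OF assms(1-3)] in simp)
  ultimately have "(\<lambda>n. 1) \<longlonglongrightarrow> \<sigma> j k * u" using tendsto_cong by fast
  then show ?thesis using LIMSEQ_unique tendsto_const by blast
qed

text \<open>The coordinates of the opposite colour inside a clique, after blowing up by the scale.\<close>

definition gap :: "nat \<Rightarrow> nat \<Rightarrow> complex" where
  "gap j k = lim (\<lambda>n. scale n * (pos (Y n) k - pos (Y n) j))"

lemma gap_tendsto:
  assumes "j \<in> V" "k \<in> V" "same_clique N X j k"
  shows "(\<lambda>n. scale n * (pos (Y n) k - pos (Y n) j)) \<longlonglongrightarrow> gap j k"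
proof -
  have "convergent (\<lambda>n. scale n * (pos (Y n) k - pos (Y n) j))"
    using assms rescaled_gap_limit[of j k]
    by (cases "j = k") (auto simp: same_clique_def convergent_def)
  then show ?thesis by (simp add: gap_def convergent_LIMSEQ_iff)
qed

lemma same_clique_refl: "same_clique N X j j" by (simp add: same_clique_def)

lemma same_clique_sym:
  assumes "j \<in> V" "k \<in> V" "same_clique N X j k" shows "same_clique N X k j"
  using assms limit_sep_antisym[of j k] by (auto simp: same_clique_def)

text \<open>The blown-up gaps of two consecutive strokes add up to a finite gap, and a finite gap forces a
  nonzero separation.\<close>

lemma same_clique_trans:
  assumes "i \<in> V" "j \<in> V" "k \<in> V" "same_clique N X i j" "same_clique N X j k"
  shows "same_clique N X i k"
proof (cases "i = k")
  case False
  have "(\<lambda>n. scale n * (pos (Y n) k - pos (Y n) i)) \<longlonglongrightarrow> gap i j + gap j k"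
    using tendsto_add[OF gap_tendsto gap_tendsto, of i j j k] assms by (simp add: algebra_simps)
  then show ?thesis using limit_sep_times_gap[of i k] assms False by (fastforce simp: same_clique_def)
qed (simp add: same_clique_refl)

text \<open>A gap of order one over the scale is invisible in positions divided by the scale.\<close>

lemma same_clique_opposite_position:
  assumes "j \<in> V" "k \<in> V" "same_clique N X j k"
  shows "\<omega> j = \<omega> k"
proof -
  interpret swap: singular_limits N \<Gamma> "cnj \<Lambda>" Y X by (rule exchanged)
  have "(\<lambda>n. scale n * (pos (Y n) k - pos (Y n) j) * (1 / scale n) * (1 / scale n)) \<longlonglongrightarrow> gap j k * 0 * 0"
    by (intro tendsto_mult gap_tendsto assms inverse_scale)
  moreover have "\<forall>\<^sub>F n in sequentially.
      scale n * (pos (Y n) k - pos (Y n) j) * (1 / scale n) * (1 / scale n) =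
      pos (Y n) k / scale n - pos (Y n) j / scale n"
    using scale_nonzero by eventually_elim (simp add: field_simps)
  ultimately have "(\<lambda>n. pos (Y n) k / scale n - pos (Y n) j / scale n) \<longlonglongrightarrow> gap j k * 0 * 0"
    using tendsto_cong by fast
  moreover have "(\<lambda>n. pos (Y n) k / scale n - pos (Y n) j / scale n) \<longlonglongrightarrow> \<omega> k - \<omega> j"
    using tendsto_diff[OF swap.pos_tendsto[OF assms(2)] swap.pos_tendsto[OF assms(1)]]
    by (simp add: same_norm)
  ultimately show ?thesis using LIMSEQ_unique by fastforce
qed

lemma clique_eq:
  assumes "a \<in> V" "b \<in> V" "same_clique N X a b" shows "clique b = clique a"
  using assms same_clique_trans same_clique_sym by blast

lemma outside_clique:
  assumes "a \<in> V" "k \<in> clique a" "j \<in> V - clique a" shows "\<sigma> j k = 0"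
proof (rule ccontr)
  assume "\<sigma> j k \<noteq> 0"
  then have "same_clique N X j k" by (simp add: same_clique_def)
  then show False using assms same_clique_sym same_clique_trans by blast
qed

lemma clique_moment:
  assumes "a \<in> V" shows "(\<Sum>k\<in>clique a. \<gamma> k * \<zeta> k) = 0"
proof -
  have "\<Lambda> * (\<Sum>k\<in>clique a. \<gamma> k * \<zeta> k) = (\<Sum>k\<in>clique a. \<gamma> k * (\<Sum>j\<in>V - {k}. \<gamma> j * \<sigma> j k))"
    unfolding sum_distrib_left[of \<Lambda>]
    by (intro sum.cong refl, subst limit_equation[symmetric]) (auto simp: mult_ac)
  also have "\<dots> = (\<Sum>k\<in>clique a. \<Sum>j\<in>V - clique a. \<gamma> k * \<gamma> j * \<sigma> j k)"
    by (rule weighted_interaction_sum) (auto intro: limit_sep_antisym)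
  also have "\<dots> = 0" using outside_clique[OF assms] by (intro sum.neutral ballI) simp
  finally show ?thesis using \<Lambda>_nonzero by simp
qed

text \<open>Weighting the equations by the blown-up opposite coordinates makes every pair contribute
  \<open>\<sigma>\<^sub>j\<^sub>k (v\<^sub>k - v\<^sub>j) = 1\<close> times the product of its vorticities, as in the virial identity for the full
  system.\<close>

lemma clique_virial:
  assumes "a \<in> V"
  shows "2 * \<Lambda> * (\<Sum>k\<in>clique a. \<gamma> k * \<zeta> k * gap a k) =
    (\<Sum>k\<in>clique a. \<gamma> k)\<^sup>2 - (\<Sum>k\<in>clique a. (\<gamma> k)\<^sup>2)"
proof -
  let ?A = "clique a" and ?v = "gap a"
  have unit: "\<sigma> j k * (?v k - ?v j) = 1" if "j \<in> ?A" "k \<in> ?A" "j \<noteq> k" for j k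
  proof -
    have "(\<lambda>n. scale n * (pos (Y n) k - pos (Y n) j)) \<longlonglongrightarrow> ?v k - ?v j"
      using tendsto_diff[OF gap_tendsto gap_tendsto, of a k a j] that \<open>a \<in> V\<close>
      by (simp add: algebra_simps)
    then show ?thesis using limit_sep_times_gap that by simp
  qed
  have inside: "\<Lambda> * \<zeta> k = (\<Sum>j\<in>?A - {k}. \<gamma> j * \<sigma> j k)" if "k \<in> ?A" for k
  proof -
    have "(\<Sum>j\<in>V - {k}. \<gamma> j * \<sigma> j k) = (\<Sum>j\<in>?A - {k}. \<gamma> j * \<sigma> j k)"
    proof (rule sum.mono_neutral_right)
      show "\<forall>j\<in>(V - {k}) - (?A - {k}). \<gamma> j * \<sigma> j k = 0"
      proof
        fix j assume "j \<in> (V - {k}) - (?A - {k})"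
        then have "\<sigma> j k = 0" by (intro outside_clique[OF \<open>a \<in> V\<close> that]) blast
        then show "\<gamma> j * \<sigma> j k = 0" by simp
      qed
    qed auto
    then show ?thesis using limit_equation that by simp
  qed
  have "(\<Sum>k\<in>?A. \<Sum>j\<in>?A - {k}. \<gamma> k * \<gamma> j * (2 * \<sigma> j k * ?v k - 1)) = 0"
  proof (rule sum_antisymmetric_eq_0)
    fix i j assume ij: "i \<in> ?A" "j \<in> ?A" "i \<noteq> j"
    have "\<sigma> j i * ?v i = 1 + \<sigma> j i * ?v j"
      using unit[OF ij(2,1)] ij(3) by (auto simp: algebra_simps)
    moreover have "\<sigma> i j = - \<sigma> j i" using ij by (intro limit_sep_antisym) auto
    ultimately have "2 * \<sigma> j i * ?v i - 1 = - (2 * \<sigma> i j * ?v j - 1)"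
      by (simp add: mult.assoc)
    then show "\<gamma> i * \<gamma> j * (2 * \<sigma> j i * gap a i - 1) = - (\<gamma> j * \<gamma> i * (2 * \<sigma> i j * gap a j - 1))"
      by (metis mult.commute mult_minus_right)
  qed simp
  moreover have "(\<Sum>k\<in>?A. \<Sum>j\<in>?A - {k}. \<gamma> k * \<gamma> j * (2 * \<sigma> j k * ?v k - 1)) =
      (\<Sum>k\<in>?A. 2 * \<gamma> k * ?v k * (\<Sum>j\<in>?A - {k}. \<gamma> j * \<sigma> j k)) - (\<Sum>k\<in>?A. \<Sum>j\<in>?A - {k}. \<gamma> k * \<gamma> j)"
    by (simp add: sum_subtractf sum_distrib_left right_diff_distrib mult_ac)
  moreover have "(\<Sum>k\<in>?A. 2 * \<gamma> k * ?v k * (\<Sum>j\<in>?A - {k}. \<gamma> j * \<sigma> j k)) =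
      2 * \<Lambda> * (\<Sum>k\<in>?A. \<gamma> k * \<zeta> k * ?v k)"
    unfolding sum_distrib_left[of "2 * \<Lambda>"]
    by (intro sum.cong refl, subst inside[symmetric]) (auto simp: mult_ac)
  ultimately show ?thesis by (simp add: sum_offdiagonal_products)
qed

text \<open>For \<open>j\<close> outside \<open>T\<close> and \<open>k \<in> T\<close> the separation \<open>W\<^sub>j\<^sub>k = 1 / (z\<^sub>k - z\<^sub>j)\<close>, multiplied by the scale,
  tends to \<open>1 / (c - \<zeta>\<^sub>j)\<close>. This limit does not depend on \<open>k\<close>, so the total vorticity of \<open>T\<close> factors
  out of the force on \<open>T\<close>.\<close>

lemma cluster_moment:
  assumes T: "T = {k \<in> V. \<zeta> k = c}" and "(\<Sum>k\<in>T. \<gamma> k) = 0"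
  shows "(\<lambda>n. scale n * (\<Sum>k\<in>T. \<gamma> k * pos (Y n) k)) \<longlonglongrightarrow> 0"
proof -
  interpret swap: singular_limits N \<Gamma> "cnj \<Lambda>" Y X by (rule exchanged)
  have "(\<lambda>n. scale n * sep (Y n) j k) \<longlonglongrightarrow> 1 / (c - \<zeta> j)" if "k \<in> T" "j \<in> V - T" for j k
  proof -
    have jk: "j \<in> V" "k \<in> V" "j \<noteq> k" "\<zeta> k = c" "\<zeta> k - \<zeta> j \<noteq> 0" using that T by auto
    have "sep (Y n) j k = 1 / (pos (X n) k - pos (X n) j)" for n
      using swap.sep_times_difference[OF jk(1-3), of n]
      by (metis nonzero_mult_div_cancel_right mult_zero_right zero_neq_one)
    then have "scale n * sep (Y n) j k = 1 / (pos (X n) k / scale n - pos (X n) j / scale n)" for n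
      by (simp add: diff_divide_distrib[symmetric])
    moreover have "(\<lambda>n. 1 / (pos (X n) k / scale n - pos (X n) j / scale n)) \<longlonglongrightarrow> 1 / (\<zeta> k - \<zeta> j)"
      using jk by (intro tendsto_divide tendsto_diff pos_tendsto tendsto_const) auto
    ultimately show ?thesis using jk by simp
  qed
  then have "(\<lambda>n. \<Sum>k\<in>T. \<Sum>j\<in>V - T. \<gamma> k * \<gamma> j * (scale n * sep (Y n) j k)) \<longlonglongrightarrow>
      (\<Sum>k\<in>T. \<Sum>j\<in>V - T. \<gamma> k * \<gamma> j * (1 / (c - \<zeta> j)))"
    by (intro tendsto_sum tendsto_mult_left)
  moreover have "(\<Sum>k\<in>T. \<Sum>j\<in>V - T. \<gamma> k * \<gamma> j * (1 / (c - \<zeta> j))) =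
      (\<Sum>k\<in>T. \<gamma> k) * (\<Sum>j\<in>V - T. \<gamma> j * (1 / (c - \<zeta> j)))"
    by (simp add: sum_product mult.assoc)
  moreover have "(\<Sum>k\<in>T. \<Sum>j\<in>V - T. \<gamma> k * \<gamma> j * (scale n * sep (Y n) j k)) =
      cnj \<Lambda> * (scale n * (\<Sum>k\<in>T. \<gamma> k * pos (Y n) k))" for n
  proof -
    have "cnj \<Lambda> * (\<Sum>k\<in>T. \<gamma> k * pos (Y n) k) = (\<Sum>k\<in>T. \<gamma> k * (\<Sum>j\<in>V - {k}. \<gamma> j * sep (Y n) j k))"
      unfolding sum_distrib_left[of "cnj \<Lambda>"]
      by (intro sum.cong refl, subst swap.equation_z[symmetric]) (use T in \<open>auto simp: mult_ac\<close>)
    also have "\<dots> = (\<Sum>k\<in>T. \<Sum>j\<in>V - T. \<gamma> k * \<gamma> j * sep (Y n) j k)"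
      by (rule weighted_interaction_sum) (use T in \<open>auto intro: sep_antisym\<close>)
    finally have *: "cnj \<Lambda> * (\<Sum>k\<in>T. \<gamma> k * pos (Y n) k) =
        (\<Sum>k\<in>T. \<Sum>j\<in>V - T. \<gamma> k * \<gamma> j * sep (Y n) j k)" .
    have "(\<Sum>k\<in>T. \<Sum>j\<in>V - T. \<gamma> k * \<gamma> j * (scale n * sep (Y n) j k)) =
        scale n * (\<Sum>k\<in>T. \<Sum>j\<in>V - T. \<gamma> k * \<gamma> j * sep (Y n) j k)"
      unfolding sum_distrib_left by (intro sum.cong refl) (rule mult.left_commute)
    then show ?thesis unfolding *[symmetric] by (simp only: mult.left_commute)
  qed
  ultimately have "(\<lambda>n. cnj \<Lambda> * (scale n * (\<Sum>k\<in>T. \<gamma> k * pos (Y n) k))) \<longlonglongrightarrow> 0"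
    using assms by simp
  from tendsto_mult_left[OF this, of "1 / cnj \<Lambda>"] show ?thesis using \<Lambda>_nonzero by simp
qed

end

section \<open>Rules that circles and vorticities impose on strokes\<close>

text \<open>Conditions on the circles \<open>C\<close> of the same colour as the cliques \<open>R\<close>: no clique has exactly one
  circled vertex, and a clique of two vertices has a circle.\<close>

definition circle_rules :: "'a set \<Rightarrow> ('a \<Rightarrow> 'a \<Rightarrow> bool) \<Rightarrow> ('a \<Rightarrow> bool) \<Rightarrow> bool" where
  "circle_rules V R C \<longleftrightarrow>
     (\<forall>j\<in>V. C j \<longrightarrow> (\<exists>k\<in>V. k \<noteq> j \<and> R j k \<and> C k)) \<and>
     (\<forall>j\<in>V. C j \<or> (\<forall>k\<in>V. k \<noteq> j \<and> R j k \<longrightarrow> (\<exists>l\<in>V. l \<noteq> j \<and> l \<noteq> k \<and> R j l)))"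

text \<open>On an \<open>R\<close>-clique the limiting position of the other colour is a constant. If all circled
  vertices of an \<open>S\<close>-clique lie in it, the moment identity of the \<open>S\<close>-clique therefore says that
  their vorticities sum to zero.\<close>

definition vanishing ::
  "'a set \<Rightarrow> ('a \<Rightarrow> 'a \<Rightarrow> bool) \<Rightarrow> ('a \<Rightarrow> 'a \<Rightarrow> bool) \<Rightarrow> ('a \<Rightarrow> bool) \<Rightarrow> 'a \<Rightarrow> 'a \<Rightarrow> bool" where
  "vanishing V R S D a t \<longleftrightarrow> D t \<and> (\<forall>l\<in>V. S t l \<and> D l \<longrightarrow> R a l)"

text \<open>The conditions come from \<open>some_clique_not_opposite\<close>, \<open>third_circle\<close>,
  \<open>some_nonvanishing\<close>, \<open>two_outside_vanishing\<close> and \<open>no_uncircled_successor\<close>; the last three speak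
  of an uncircled clique.\<close>

definition vorticity_rules ::
  "'a set \<Rightarrow> ('a \<Rightarrow> 'a \<Rightarrow> bool) \<Rightarrow> ('a \<Rightarrow> 'a \<Rightarrow> bool) \<Rightarrow> ('a \<Rightarrow> bool) \<Rightarrow> ('a \<Rightarrow> bool) \<Rightarrow> bool" where
  "vorticity_rules V R S C D \<longleftrightarrow>
     ((\<exists>j\<in>V. C j) \<longrightarrow> (\<exists>j\<in>V. C j \<and> (\<exists>k\<in>V. R j k \<and> \<not> S j k))) \<and>
     (\<forall>a\<in>V. C a \<longrightarrow> (\<forall>b\<in>V. b \<noteq> a \<and> S a b \<longrightarrow> (\<exists>k\<in>V. k \<noteq> a \<and> k \<noteq> b \<and> C k))) \<and>
     (\<forall>a\<in>V. (\<exists>k\<in>V. R a k \<and> C k) \<or>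
        (\<exists>k\<in>V. R a k \<and> \<not> vanishing V R S D a k) \<and>
        (\<forall>t\<in>V. R a t \<and> vanishing V R S D a t \<longrightarrow>
           (\<exists>k\<in>V. R a k \<and> \<not> S t k \<and> (\<exists>l\<in>V. l \<noteq> k \<and> R a l \<and> \<not> S t l))) \<and>
        (\<forall>x\<in>V. \<not> R a x \<and> S a x \<and> (\<forall>k\<in>V. S a k \<longleftrightarrow> R a k \<or> k = x) \<longrightarrow>
           (\<exists>k\<in>V. S a k \<and> D k)))"

context singular_limits
begin

lemma sum_squares_positive:
  assumes "a \<in> B" "B \<subseteq> V" shows "0 < (\<Sum>k\<in>B. (\<Gamma> k)\<^sup>2)"
  using assms vorticity finite_subset[OF \<open>B \<subseteq> V\<close>] by (intro sum_pos2[of B a]) auto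

text \<open>The left-hand side of the virial identity vanishes. In particular the total vorticity of an
  uncircled clique is nonzero.\<close>

lemma uncircled_clique:
  assumes "a \<in> V" and "\<And>k. k \<in> clique a \<Longrightarrow> \<zeta> k = 0"
  shows "(\<Sum>k\<in>clique a. \<Gamma> k)\<^sup>2 = (\<Sum>k\<in>clique a. (\<Gamma> k)\<^sup>2)"
proof -
  have "(\<Sum>k\<in>clique a. \<gamma> k * \<zeta> k * gap a k) = 0" using assms(2) by (intro sum.neutral ballI) simp
  then have "(\<Sum>k\<in>clique a. \<gamma> k)\<^sup>2 = (\<Sum>k\<in>clique a. (\<gamma> k)\<^sup>2)"
    using clique_virial[OF \<open>a \<in> V\<close>] by simp
  then have "complex_of_real ((\<Sum>k\<in>clique a. \<Gamma> k)\<^sup>2) = of_real (\<Sum>k\<in>clique a. (\<Gamma> k)\<^sup>2)" by simp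
  then show ?thesis unfolding of_real_eq_iff .
qed

text \<open>For constant nonzero \<open>\<zeta>\<close> the moment identity makes the total vorticity vanish. The blown-up moment
  of the clique then does not depend on a base point, and the virial identity evaluates it to a
  nonzero number.\<close>

lemma uniformly_circled_clique:
  assumes "a \<in> V" "c \<noteq> 0" and \<zeta>: "\<And>k. k \<in> clique a \<Longrightarrow> \<zeta> k = c"
  shows "(\<Sum>k\<in>clique a. \<gamma> k) = 0"
    and "(\<lambda>n. 2 * \<Lambda> * c * (scale n * (\<Sum>k\<in>clique a. \<gamma> k * pos (Y n) k)))
      \<longlonglongrightarrow> - (\<Sum>k\<in>clique a. (\<gamma> k)\<^sup>2)"
proof -
  have "(\<Sum>k\<in>clique a. \<gamma> k * \<zeta> k) = (\<Sum>k\<in>clique a. \<gamma> k) * c"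
    unfolding sum_distrib_right using \<zeta> by (intro sum.cong refl) simp
  then show total: "(\<Sum>k\<in>clique a. \<gamma> k) = 0"
    using clique_moment[OF \<open>a \<in> V\<close>] \<open>c \<noteq> 0\<close> by simp
  have "(\<Sum>k\<in>clique a. \<gamma> k * \<zeta> k * gap a k) = c * (\<Sum>k\<in>clique a. \<gamma> k * gap a k)"
    unfolding sum_distrib_left using \<zeta> by (intro sum.cong refl) simp
  then have weighted: "2 * \<Lambda> * c * (\<Sum>k\<in>clique a. \<gamma> k * gap a k) = - (\<Sum>k\<in>clique a. (\<gamma> k)\<^sup>2)"
    using clique_virial[OF \<open>a \<in> V\<close>] total by (simp add: mult.assoc)
  have "scale n * (\<Sum>k\<in>clique a. \<gamma> k * pos (Y n) k) =
      (\<Sum>k\<in>clique a. \<gamma> k * (scale n * (pos (Y n) k - pos (Y n) a)))" for n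
  proof -
    have "(\<Sum>k\<in>clique a. \<gamma> k * (scale n * (pos (Y n) k - pos (Y n) a))) =
        scale n * ((\<Sum>k\<in>clique a. \<gamma> k * pos (Y n) k) - (\<Sum>k\<in>clique a. \<gamma> k) * pos (Y n) a)"
      unfolding sum_distrib_right sum_subtractf[symmetric] sum_distrib_left
      by (intro sum.cong refl) (simp add: algebra_simps)
    then show ?thesis using total by simp
  qed
  moreover have "(\<lambda>n. \<Sum>k\<in>clique a. \<gamma> k * (scale n * (pos (Y n) k - pos (Y n) a)))
      \<longlonglongrightarrow> (\<Sum>k\<in>clique a. \<gamma> k * gap a k)"
    by (intro tendsto_sum tendsto_mult_left gap_tendsto) (use assms in auto)
  ultimately have "(\<lambda>n. scale n * (\<Sum>k\<in>clique a. \<gamma> k * pos (Y n) k))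
      \<longlonglongrightarrow> (\<Sum>k\<in>clique a. \<gamma> k * gap a k)" by (simp only:)
  from tendsto_mult_left[OF this, of "2 * \<Lambda> * c"]
  show "(\<lambda>n. 2 * \<Lambda> * c * (scale n * (\<Sum>k\<in>clique a. \<gamma> k * pos (Y n) k)))
      \<longlonglongrightarrow> - (\<Sum>k\<in>clique a. (\<gamma> k)\<^sup>2)" unfolding weighted .
qed

lemma circled_partner:
  assumes "j \<in> V" "\<zeta> j \<noteq> 0" shows "\<exists>k\<in>V. k \<noteq> j \<and> same_clique N X j k \<and> \<zeta> k \<noteq> 0"
proof (rule ccontr)
  assume "\<not> ?thesis"
  then have "(\<Sum>k\<in>clique j. \<gamma> k * \<zeta> k) = (\<Sum>k\<in>{j}. \<gamma> k * \<zeta> k)"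
    using assms same_clique_refl by (intro sum.mono_neutral_right) auto
  then show False using clique_moment assms vorticity by auto
qed

lemma circle_rules: "circle_rules V (same_clique N X) (\<lambda>k. \<zeta> k \<noteq> 0)"
  unfolding circle_rules_def
proof (intro conjI ballI)
  fix j assume "j \<in> V"
  show "\<zeta> j \<noteq> 0 \<or> (\<forall>k\<in>V. k \<noteq> j \<and> same_clique N X j k \<longrightarrow>
      (\<exists>l\<in>V. l \<noteq> j \<and> l \<noteq> k \<and> same_clique N X j l))"
  proof (rule ccontr)
    assume "\<not> ?thesis"
    then obtain k where k: "k \<in> V" "k \<noteq> j" "same_clique N X j k" "\<zeta> j = 0"
      and only: "\<And>l. \<lbrakk>l \<in> V; l \<noteq> j; same_clique N X j l\<rbrakk> \<Longrightarrow> l = k" by blast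
    have pair: "clique j = {j, k}" using \<open>j \<in> V\<close> k same_clique_refl only by blast
    have "\<gamma> k * \<zeta> k = 0" using clique_moment[OF \<open>j \<in> V\<close>] k unfolding pair by simp
    then have "\<zeta> i = 0" if "i \<in> clique j" for i
      using that k vorticity[OF \<open>k \<in> V\<close>] unfolding pair by auto
    from uncircled_clique[OF \<open>j \<in> V\<close> this] k have "\<Gamma> j * \<Gamma> k = 0"
      unfolding pair by (simp add: power2_sum)
    then show False using vorticity \<open>j \<in> V\<close> k by auto
  qed
qed (use circled_partner in blast)

text \<open>Otherwise \<open>\<zeta>\<close> would be constant on every clique that meets the set \<open>T\<close> of vertices with a fixed
  nonzero value of \<open>\<zeta>\<close>, and \<open>T\<close> would be a union of cliques. The blown-up moments of these cliques
  have limits that are negative multiples of one complex number and cannot cancel, whereas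
  \<open>cluster_moment\<close> says that they sum to zero.\<close>

lemma some_clique_not_opposite:
  assumes "j \<in> V" "\<zeta> j \<noteq> 0"
  shows "\<exists>j\<in>V. \<zeta> j \<noteq> 0 \<and> (\<exists>k\<in>V. same_clique N X j k \<and> \<not> same_clique N Y j k)"
proof (rule ccontr)
  interpret swap: singular_limits N \<Gamma> "cnj \<Lambda>" Y X by (rule exchanged)
  assume "\<not> ?thesis"
  then have nested: "\<And>i k. \<lbrakk>i \<in> V; \<zeta> i \<noteq> 0; k \<in> V; same_clique N X i k\<rbrakk> \<Longrightarrow> same_clique N Y i k" by blast
  define c T where "c = \<zeta> j" and "T = {k \<in> V. \<zeta> k = c}"
  have "c \<noteq> 0" "T \<subseteq> V" "finite T" "j \<in> T" using assms by (auto simp: c_def T_def)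
  have const: "\<zeta> l = c" if "k \<in> T" "l \<in> clique k" for k l
    using that nested[of k l] swap.same_clique_opposite_position[of k l] \<open>c \<noteq> 0\<close>
    by (auto simp: T_def)
  then have sub: "clique k \<subseteq> T" if "k \<in> T" for k using that by (auto simp: T_def)
  have fibre: "{l \<in> T. clique l = B} = B" if "B \<in> clique ` T" for B
  proof -
    from that obtain k where k: "k \<in> T" "B = clique k" by blast
    have "l \<in> clique k" if "l \<in> T" "clique l = clique k" for l
      using that \<open>T \<subseteq> V\<close> same_clique_refl by blast
    moreover have "clique l = clique k" if "l \<in> clique k" for l
      using that k \<open>T \<subseteq> V\<close> clique_eq by blast
    ultimately show ?thesis using k sub by blast
  qed
  have split: "(\<Sum>k\<in>T. h k) = (\<Sum>B\<in>clique ` T. \<Sum>k\<in>B. h k)" for h :: "nat \<Rightarrow> complex"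
    using sum.image_gen[OF \<open>finite T\<close>, of h clique] fibre by (simp cong: sum.cong)
  have zero: "(\<Sum>k\<in>B. \<gamma> k) = 0" if "B \<in> clique ` T" for B
    using that uniformly_circled_clique(1)[OF _ \<open>c \<noteq> 0\<close>] const \<open>T \<subseteq> V\<close> by blast
  have "(\<Sum>k\<in>T. \<gamma> k) = 0" unfolding split by (intro sum.neutral ballI zero)
  from tendsto_mult_left[OF cluster_moment[OF T_def this], of "2 * \<Lambda> * c"]
  have "(\<lambda>n. 2 * \<Lambda> * c * (scale n * (\<Sum>k\<in>T. \<gamma> k * pos (Y n) k))) \<longlonglongrightarrow> 0" by simp
  moreover have "2 * \<Lambda> * c * (scale n * (\<Sum>k\<in>T. \<gamma> k * pos (Y n) k)) =
      (\<Sum>B\<in>clique ` T. 2 * \<Lambda> * c * (scale n * (\<Sum>k\<in>B. \<gamma> k * pos (Y n) k)))" for n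
    unfolding split by (simp only: sum_distrib_left)
  moreover have "(\<lambda>n. \<Sum>B\<in>clique ` T. 2 * \<Lambda> * c * (scale n * (\<Sum>k\<in>B. \<gamma> k * pos (Y n) k)))
      \<longlonglongrightarrow> (\<Sum>B\<in>clique ` T. - (\<Sum>k\<in>B. (\<gamma> k)\<^sup>2))"
    using uniformly_circled_clique(2)[OF _ \<open>c \<noteq> 0\<close>] const \<open>T \<subseteq> V\<close>
    by (intro tendsto_sum) blast
  ultimately have "(\<Sum>B\<in>clique ` T. - (\<Sum>k\<in>B. (\<gamma> k)\<^sup>2)) = 0"
    using LIMSEQ_unique by (simp only:) blast
  then have "(\<Sum>k\<in>T. (\<gamma> k)\<^sup>2) = 0" unfolding split by (simp add: sum_negf)
  then have "complex_of_real (\<Sum>k\<in>T. (\<Gamma> k)\<^sup>2) = 0" by simp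
  then show False using sum_squares_positive[OF \<open>j \<in> T\<close> \<open>T \<subseteq> V\<close>] unfolding of_real_eq_0_iff by simp
qed

text \<open>If \<open>a\<close> and \<open>b\<close> were the only circled vertices, they would share a clique and have opposite
  vorticities. Then \<open>cluster_moment\<close> makes the blown-up gap between \<open>a\<close> and \<open>b\<close> tend to zero, which
  is incompatible with the stroke \<open>ab\<close>.\<close>

lemma third_circle:
  assumes "a \<in> V" "\<zeta> a \<noteq> 0" "b \<in> V" "b \<noteq> a" "same_clique N Y a b"
  shows "\<exists>k\<in>V. k \<noteq> a \<and> k \<noteq> b \<and> \<zeta> k \<noteq> 0"
proof (rule ccontr)
  interpret swap: singular_limits N \<Gamma> "cnj \<Lambda>" Y X by (rule exchanged)
  assume "\<not> ?thesis"
  then have others: "\<And>k. \<lbrakk>k \<in> V; k \<noteq> a; k \<noteq> b\<rbrakk> \<Longrightarrow> \<zeta> k = 0" by blast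
  have eq: "\<zeta> b = \<zeta> a" using swap.same_clique_opposite_position[OF assms(1,3,5)] by simp
  have ab: "same_clique N X a b" using circled_partner[OF assms(1,2)] others by blast
  have T: "{a, b} = {k \<in> V. \<zeta> k = \<zeta> a}" 
  proof (intro equalityI subsetI)
    fix k assume "k \<in> {k \<in> V. \<zeta> k = \<zeta> a}"
    then show "k \<in> {a, b}" using others[of k] \<open>\<zeta> a \<noteq> 0\<close> by auto
  qed (use assms eq in auto)
  have "(\<Sum>k\<in>clique a. \<gamma> k * \<zeta> k) = (\<Sum>k\<in>{a, b}. \<gamma> k * \<zeta> k)"
    using assms ab others same_clique_refl by (intro sum.mono_neutral_right) auto
  then have "(\<gamma> a + \<gamma> b) * \<zeta> a = 0"
    using clique_moment[OF \<open>a \<in> V\<close>] eq \<open>b \<noteq> a\<close> by (simp add: distrib_right)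
  then have opp: "\<gamma> a = - \<gamma> b" using \<open>\<zeta> a \<noteq> 0\<close> by (simp add: add_eq_0_iff2)
  have "(\<lambda>n. scale n * (\<Sum>k\<in>{a, b}. \<gamma> k * pos (Y n) k)) \<longlonglongrightarrow> 0"
    by (rule cluster_moment[OF T]) (use opp \<open>b \<noteq> a\<close> in auto)
  moreover have "scale n * (\<Sum>k\<in>{a, b}. \<gamma> k * pos (Y n) k) =
      \<gamma> b * (scale n * (pos (Y n) b - pos (Y n) a))" for n
    using \<open>b \<noteq> a\<close> opp by (simp add: algebra_simps)
  moreover have "(\<lambda>n. \<gamma> b * (scale n * (pos (Y n) b - pos (Y n) a))) \<longlonglongrightarrow> \<gamma> b * gap a b"
    by (intro tendsto_mult_left gap_tendsto assms ab)
  ultimately have "\<gamma> b * gap a b = 0" using LIMSEQ_unique by (simp only:) blast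
  moreover have "\<sigma> a b * gap a b = 1"
    using assms by (intro limit_sep_times_gap gap_tendsto ab) auto
  ultimately show False using vorticity[OF \<open>b \<in> V\<close>] by auto
qed

abbreviation "vanishing_at \<equiv> vanishing V (same_clique N X) (same_clique N Y) (\<lambda>k. \<omega> k \<noteq> 0)"

text \<open>On the clique of \<open>a\<close> the opposite position is a constant; it is nonzero because \<open>t\<close> is circled. The
  moment identity of the opposite clique of \<open>t\<close> therefore reduces to a sum of vorticities.\<close>

lemma vanishing_sum:
  assumes "a \<in> V" "t \<in> clique a" "vanishing_at a t"
  shows "(\<Sum>k\<in>{k \<in> clique a. same_clique N Y t k}. \<Gamma> k) = 0"
proof -
  interpret swap: singular_limits N \<Gamma> "cnj \<Lambda>" Y X by (rule exchanged)
  let ?T = "{k \<in> clique a. same_clique N Y t k}"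
  have const: "\<omega> k = \<omega> t" if "k \<in> clique a" for k
    using that assms same_clique_opposite_position[of a k] same_clique_opposite_position[of a t] by simp
  have "(\<Sum>k\<in>swap.clique t. \<gamma> k * \<omega> k) = (\<Sum>k\<in>?T. \<gamma> k * \<omega> k)"
    using assms by (intro sum.mono_neutral_right) (auto simp: vanishing_def)
  also have "\<dots> = (\<Sum>k\<in>?T. \<gamma> k) * \<omega> t"
    unfolding sum_distrib_right using const by (intro sum.cong refl) simp
  finally have "(\<Sum>k\<in>?T. \<gamma> k) = 0" using assms swap.clique_moment[of t] by (simp add: vanishing_def)
  then have "complex_of_real (\<Sum>k\<in>?T. \<Gamma> k) = 0" by simp
  then show ?thesis unfolding of_real_eq_0_iff .
qed

context
  fixes a
  assumes a: "a \<in> V" and uncircled: "\<And>k. k \<in> clique a \<Longrightarrow> \<zeta> k = 0"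
begin

lemma clique_total_nonzero: "(\<Sum>k\<in>clique a. \<Gamma> k) \<noteq> 0"
proof
  assume "(\<Sum>k\<in>clique a. \<Gamma> k) = 0"
  then have "(\<Sum>k\<in>clique a. (\<Gamma> k)\<^sup>2) = 0" using uncircled_clique[OF a uncircled] by simp
  moreover have "0 < (\<Sum>k\<in>clique a. (\<Gamma> k)\<^sup>2)"
    using a same_clique_refl by (intro sum_squares_positive) auto
  ultimately show False by simp
qed

text \<open>Otherwise the clique would split into parts of total vorticity zero.\<close>

lemma some_nonvanishing: "\<exists>k\<in>V. same_clique N X a k \<and> \<not> vanishing_at a k"
proof (rule ccontr)
  interpret swap: singular_limits N \<Gamma> "cnj \<Lambda>" Y X by (rule exchanged)
  assume "\<not> ?thesis"
  then have all: "vanishing_at a k" if "k \<in> clique a" for k using that by blast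
  let ?g = "\<lambda>k. {l \<in> clique a. same_clique N Y k l}"
  have "{l \<in> clique a. ?g l = ?g k} = ?g k" if "k \<in> clique a" for k
    using that swap.same_clique_refl swap.same_clique_sym swap.same_clique_trans by blast
  then have "(\<Sum>l\<in>{l \<in> clique a. ?g l = B}. \<Gamma> l) = 0" if "B \<in> ?g ` clique a" for B
    using that vanishing_sum[OF a _ all] by fastforce
  then have "(\<Sum>k\<in>clique a. \<Gamma> k) = 0"
    using sum.image_gen[of "clique a" \<Gamma> ?g] by simp
  then show False using clique_total_nonzero by simp
qed

text \<open>The vanishing part drops out of the total vorticity. If at most one further vertex remained, the
  square of the total would be smaller than the sum of the squares.\<close>

lemma two_outside_vanishing:
  assumes t: "t \<in> clique a" "vanishing_at a t"
  shows "\<exists>k\<in>V. same_clique N X a k \<and> \<not> same_clique N Y t k \<and>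
    (\<exists>l\<in>V. l \<noteq> k \<and> same_clique N X a l \<and> \<not> same_clique N Y t l)"
proof (rule ccontr)
  assume neg: "\<not> ?thesis"
  let ?T = "{k \<in> clique a. same_clique N Y t k}"
  have "clique a - ?T = {} \<or> (\<exists>x. clique a - ?T = {x})" using neg by blast
  then have rest: "(\<Sum>k\<in>clique a - ?T. \<Gamma> k)\<^sup>2 = (\<Sum>k\<in>clique a - ?T. (\<Gamma> k)\<^sup>2)"
  proof (elim disjE exE)
    assume "clique a - ?T = {}" then show ?thesis by (simp only: sum.empty) simp
  next
    fix x assume "clique a - ?T = {x}" then show ?thesis by (simp only:) simp
  qed
  have split: "(\<Sum>k\<in>clique a. h k) = (\<Sum>k\<in>clique a - ?T. h k) + (\<Sum>k\<in>?T. h k)" for h :: "nat \<Rightarrow> real"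
    by (rule sum.subset_diff) auto
  have "(\<Sum>k\<in>?T. (\<Gamma> k)\<^sup>2) = 0"
    using uncircled_clique[OF a uncircled] vanishing_sum[OF a t] rest
    unfolding split[of \<Gamma>] split[of "\<lambda>k. (\<Gamma> k)\<^sup>2"] by simp
  moreover have "0 < (\<Sum>k\<in>?T. (\<Gamma> k)\<^sup>2)"
    using t by (intro sum_squares_positive[of t]) (auto simp: same_clique_def)
  ultimately show False by simp
qed

text \<open>The virial identities of the two uncircled cliques differ by the interaction of \<open>x\<close> with the clique
  of \<open>a\<close>, so the total vorticity of the latter would have to vanish.\<close>

lemma no_uncircled_successor:
  assumes x: "x \<in> V" "\<not> same_clique N X a x" "same_clique N Y a x"
    and succ: "\<And>k. k \<in> V \<Longrightarrow> same_clique N Y a k \<longleftrightarrow> same_clique N X a k \<or> k = x"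
  shows "\<exists>k\<in>V. same_clique N Y a k \<and> \<omega> k \<noteq> 0"
proof (rule ccontr)
  interpret swap: singular_limits N \<Gamma> "cnj \<Lambda>" Y X by (rule exchanged)
  assume "\<not> ?thesis"
  then have "(\<Sum>k\<in>swap.clique a. \<Gamma> k)\<^sup>2 = (\<Sum>k\<in>swap.clique a. (\<Gamma> k)\<^sup>2)"
    using a by (intro swap.uncircled_clique) auto
  moreover have "swap.clique a = insert x (clique a)" using x succ by auto
  moreover have "x \<notin> clique a" using x by simp
  ultimately have "\<Gamma> x * (\<Sum>k\<in>clique a. \<Gamma> k) = 0"
    using uncircled_clique[OF a uncircled] by (simp add: power2_sum)
  then show False using vorticity[OF \<open>x \<in> V\<close>] clique_total_nonzero by simp
qed

end

lemma vorticity_rules: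
  "vorticity_rules V (same_clique N X) (same_clique N Y) (\<lambda>k. \<zeta> k \<noteq> 0) (\<lambda>k. \<omega> k \<noteq> 0)"
  unfolding vorticity_rules_def
proof (intro conjI impI ballI)
  show "\<exists>j\<in>V. \<zeta> j \<noteq> 0 \<and> (\<exists>k\<in>V. same_clique N X j k \<and> \<not> same_clique N Y j k)"
    if "\<exists>j\<in>V. \<zeta> j \<noteq> 0" using that some_clique_not_opposite by blast
  show "\<exists>k\<in>V. k \<noteq> a \<and> k \<noteq> b \<and> \<zeta> k \<noteq> 0"
    if "a \<in> V" "\<zeta> a \<noteq> 0" "b \<in> V" "b \<noteq> a \<and> same_clique N Y a b" for a b
    using that third_circle by blast
  fix a assume "a \<in> V"
  let ?rest = "(\<exists>k\<in>V. same_clique N X a k \<and> \<not> vanishing_at a k) \<and>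
     (\<forall>t\<in>V. same_clique N X a t \<and> vanishing_at a t \<longrightarrow>
       (\<exists>k\<in>V. same_clique N X a k \<and> \<not> same_clique N Y t k \<and>
         (\<exists>l\<in>V. l \<noteq> k \<and> same_clique N X a l \<and> \<not> same_clique N Y t l))) \<and>
     (\<forall>x\<in>V. \<not> same_clique N X a x \<and> same_clique N Y a x \<and>
       (\<forall>k\<in>V. same_clique N Y a k \<longleftrightarrow> same_clique N X a k \<or> k = x) \<longrightarrow>
       (\<exists>k\<in>V. same_clique N Y a k \<and> \<omega> k \<noteq> 0))"
  have ?rest if uncircled: "\<And>k. k \<in> clique a \<Longrightarrow> \<zeta> k = 0"
    using some_nonvanishing[OF \<open>a \<in> V\<close> uncircled] two_outside_vanishing[OF \<open>a \<in> V\<close> uncircled]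
      no_uncircled_successor[OF \<open>a \<in> V\<close> uncircled]
    by blast
  then show "(\<exists>k\<in>V. same_clique N X a k \<and> \<zeta> k \<noteq> 0) \<or> ?rest" by blast
qed

end

section \<open>The diagram as limit data\<close>

context singular_limits
begin

text \<open>Eventually \<open>\<epsilon>\<^sup>-\<^sup>2\<close> is the norm itself, and a convergent quotient is bounded together with its
  inverse iff its limit is nonzero.\<close>

lemma comparable_iff:
  assumes "(\<lambda>n. u n / scale n) \<longlonglongrightarrow> l"
  shows "comparable u (\<lambda>n. of_real (eps N (X n) powi -2)) \<longleftrightarrow> l \<noteq> 0"
proof -
  let ?e = "\<lambda>n. complex_of_real (eps N (X n) powi -2)"
  have eq: "\<forall>\<^sub>F n in sequentially. ?e n = scale n"
    using scale_positive by eventually_elim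
      (simp add: eps_def power_int_minus power_int_numeral power_divide)
  have "\<forall>\<^sub>F n in sequentially. u n / scale n = u n / ?e n" using eq by eventually_elim simp
  then have lim: "(\<lambda>n. u n / ?e n) \<longlonglongrightarrow> l" using assms tendsto_cong by fast
  have e0: "\<forall>\<^sub>F n in sequentially. ?e n \<noteq> 0"
    using eq scale_nonzero by eventually_elim simp
  show ?thesis
  proof
    assume "l \<noteq> 0"
    have "\<forall>\<^sub>F n in sequentially. u n / ?e n \<noteq> 0"
      by (rule tendsto_imp_eventually_ne[OF lim \<open>l \<noteq> 0\<close>])
    then have "\<forall>\<^sub>F n in sequentially. u n \<noteq> 0 \<and> ?e n \<noteq> 0"
      using e0 by eventually_elim auto
    moreover have "Bseq (\<lambda>n. u n / ?e n)"
      using lim convergent_imp_Bseq convergent_def by blast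
    moreover have "(\<lambda>n. ?e n / u n) \<longlonglongrightarrow> 1 / l"
      using tendsto_divide[OF tendsto_const[of 1] lim \<open>l \<noteq> 0\<close>] by simp
    then have "Bseq (\<lambda>n. ?e n / u n)"
      using convergent_imp_Bseq convergent_def by blast
    ultimately show "comparable u ?e" by (simp add: comparable_def)
  next
    assume comp: "comparable u ?e"
    show "l \<noteq> 0"
    proof
      assume "l = 0"
      then have "Zfun (\<lambda>n. u n / ?e n) sequentially" using lim by (simp add: tendsto_Zfun_iff)
      moreover have "Bseq (\<lambda>n. ?e n / u n)" using comp by (simp add: comparable_def)
      ultimately have "(\<lambda>n. u n / ?e n * (?e n / u n)) \<longlonglongrightarrow> 0"
        using bounded_bilinear.Zfun_prod_Bfun[OF bounded_bilinear_mult] by (fastforce simp: tendsto_Zfun_iff)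
      moreover have "\<forall>\<^sub>F n in sequentially. u n / ?e n * (?e n / u n) = 1"
        using comp unfolding comparable_def by (auto elim: eventually_mono)
      ultimately have "(\<lambda>n. 1 :: complex) \<longlonglongrightarrow> 0" using tendsto_cong by fast
      then show False using LIMSEQ_unique tendsto_const zero_neq_one by blast
    qed
  qed
qed

lemma strokes_eq:
  "strokes N (\<lambda>n. eps N (X n)) X =
     {{j, k} | j k. 1 \<le> j \<and> j < k \<and> k \<le> N \<and> same_clique N X j k}"
proof -
  have "comparable (\<lambda>n. sep (X n) j k) (\<lambda>n. of_real (eps N (X n) powi -2)) \<longleftrightarrow> same_clique N X j k"
    if "1 \<le> j" "j < k" "k \<le> N" for j k
    using comparable_iff[OF sep_tendsto[of j k]] that by (simp add: same_clique_def)
  then show ?thesis unfolding strokes_def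
    by (intro Collect_cong ex_cong1 conj_cong refl) simp_all
qed

lemma circles_eq: "circles N (\<lambda>n. eps N (X n)) X = {k \<in> V. \<zeta> k \<noteq> 0}"
  unfolding circles_def using comparable_iff[OF pos_tendsto] by blast

lemma diagram_eq:
  "diagram_of N X Y = Diagram
     {{j, k} | j k. 1 \<le> j \<and> j < k \<and> k \<le> N \<and> same_clique N X j k}
     {{j, k} | j k. 1 \<le> j \<and> j < k \<and> k \<le> N \<and> same_clique N Y j k}
     {k \<in> V. \<zeta> k \<noteq> 0} {k \<in> V. \<omega> k \<noteq> 0}"
proof -
  interpret swap: singular_limits N \<Gamma> "cnj \<Lambda>" Y X by (rule exchanged)
  have "eps N (Y n) = eps N (X n)" for n by (simp add: eps_def same_norm)
  then show ?thesis
    using swap.strokes_eq swap.circles_eq strokes_eq circles_eq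
    by (simp add: diagram_of_def Let_def)
qed

lemma some_stroke: "\<exists>j\<in>V. \<exists>k\<in>V. j \<noteq> k \<and> same_clique N X j k"
proof -
  obtain i where i: "i \<in> indices N" and norm: "\<And>n. cmod (X n i) = max_norm N (X n)"
    using singular unfolding singular_sequence_def by blast
  define l where "l = lim (\<lambda>n. X n i / scale n)"
  have "(\<lambda>n. cmod (X n i / scale n)) \<longlonglongrightarrow> cmod l"
    unfolding l_def by (intro tendsto_norm component_converges i)
  moreover have "\<forall>\<^sub>F n in sequentially. cmod (X n i / scale n) = 1"
    using scale_positive by eventually_elim (simp add: norm_divide norm)
  ultimately have "(\<lambda>n. 1 :: real) \<longlonglongrightarrow> cmod l" using tendsto_cong by fast
  then have "l \<noteq> 0" using LIMSEQ_unique tendsto_const by fastforce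
  from i consider k where "k \<in> V" "i = Vert k" | j k where "1 \<le> j" "j < k" "k \<le> N" "i = Sep j k"
    by (auto simp: indices_def)
  then show ?thesis
  proof cases
    case 1
    then have "\<zeta> k \<noteq> 0" using \<open>l \<noteq> 0\<close> by (simp add: l_def limit_pos_def pos_def)
    from circled_partner[OF \<open>k \<in> V\<close> this] show ?thesis using \<open>k \<in> V\<close> by metis
  next
    case 2
    then have "\<sigma> j k \<noteq> 0" using \<open>l \<noteq> 0\<close> by (simp add: l_def limit_sep_def sep_def)
    then show ?thesis using 2 by (intro bexI[of _ j] bexI[of _ k]) (simp_all add: same_clique_def)
  qed
qed

end

section \<open>Enumeration of partitions and circles\<close>

text \<open>A partition of \<open>{0..<n}\<close> is encoded by the list that labels every element with the least element of
  its class.\<close>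

fun growth_lists :: "nat \<Rightarrow> nat list list" where
  "growth_lists 0 = [[]]"
| "growth_lists (Suc n) =
    concat (map (\<lambda>l. map (\<lambda>i. l @ [i]) (filter (\<lambda>i. i = n \<or> l ! i = i) [0..<Suc n]))
      (growth_lists n))"

lemma growth_lists_properties:
  assumes "l \<in> set (growth_lists n)"
  shows "length l = n \<and> (\<forall>i<n. l ! i \<le> i \<and> l ! (l ! i) = l ! i)"
  using assms
proof (induction n arbitrary: l)
  case (Suc n)
  then obtain l' x where l': "l' \<in> set (growth_lists n)" "l = l' @ [x]" "x \<le> n" "x = n \<or> l' ! x = x"
    by (auto simp: less_Suc_eq_le)
  have *: "length l' = n" "\<And>i. i < n \<Longrightarrow> l' ! i \<le> i \<and> l' ! (l' ! i) = l' ! i"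
    using Suc.IH[OF l'(1)] by auto
  have "l ! i \<le> i \<and> l ! (l ! i) = l ! i" if "i < Suc n" for i
  proof (cases "i < n")
    case True
    then have "l' ! i < n" using *(2)[OF True] by simp
    then show ?thesis using *(2)[OF True] l'(2) *(1) True by (simp add: nth_append)
  next
    case False
    then have "i = n" using that by simp
    then show ?thesis using l' *(1) by (cases "x = n") (auto simp: nth_append)
  qed
  then show ?case using l'(2) *(1) by simp
qed simp

lemma growth_lists_SucI:
  assumes "l \<in> set (growth_lists n)" "i = n \<or> i < n \<and> l ! i = i"
  shows "l @ [i] \<in> set (growth_lists (Suc n))"
proof -
  have "i \<in> set (filter (\<lambda>i. i = n \<or> l ! i = i) [0..<Suc n])"
    using assms(2) unfolding set_filter set_upt by (intro CollectI) fastforce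
  then show ?thesis using assms(1) unfolding growth_lists.simps set_concat set_map image_image by (intro UN_I[of l] imageI)
qed
lemma growth_list_of_equivalence:
  assumes "\<And>i. i < n \<Longrightarrow> R i i"
    and "\<And>i j. \<lbrakk>i < n; j < n; R i j\<rbrakk> \<Longrightarrow> R j i"
    and "\<And>i j k. \<lbrakk>i < n; j < n; k < n; R i j; R j k\<rbrakk> \<Longrightarrow> R i k"
  shows "\<exists>l \<in> set (growth_lists n). \<forall>i<n. \<forall>j<n. R i j \<longleftrightarrow> l ! i = l ! j"
  using assms
proof (induction n)
  case 0
  show ?case by simp
next
  case (Suc n)
  have "\<exists>l \<in> set (growth_lists n). \<forall>i<n. \<forall>j<n. R i j \<longleftrightarrow> l ! i = l ! j"
  proof (rule Suc.IH)
    show "R i i" if "i < n" for i using Suc.prems(1) that by simp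
    show "R j i" if "i < n" "j < n" "R i j" for i j using Suc.prems(2)[of i j] that by simp
    show "R i k" if "i < n" "j < n" "k < n" "R i j" "R j k" for i j k
      using Suc.prems(3)[of i j k] that by simp
  qed
  then obtain l where l: "l \<in> set (growth_lists n)"
    and R: "\<And>i j. \<lbrakk>i < n; j < n\<rbrakk> \<Longrightarrow> R i j \<longleftrightarrow> l ! i = l ! j" by blast
  note props = growth_lists_properties[OF l]
  have len: "length l = n" using props by simp
  have bound: "l ! i < n" if "i < n" for i using props that by (meson le_less_trans)
  show ?case
  proof (cases "\<exists>i<n. R i n")
    case True
    then obtain i where i: "i < n" "R i n" by blast
    let ?l = "l @ [l ! i]"
    have "l ! (l ! i) = l ! i" using props i by blast
    then have mem: "?l \<in> set (growth_lists (Suc n))" using bound[OF i(1)] by (intro growth_lists_SucI[OF l]) simp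
    have new: "R j n \<longleftrightarrow> l ! j = l ! i" if "j < n" for j
    proof -
      have "R n i" using Suc.prems(2)[of i n] i by simp
      then have "R j n \<longleftrightarrow> R j i"
        using Suc.prems(3)[of j i n] Suc.prems(3)[of j n i] that i by fastforce
      then show ?thesis using R that i by blast
    qed
    have new': "R n j \<longleftrightarrow> l ! i = l ! j" if "j < n" for j
      using new[OF that] Suc.prems(2)[of n j] Suc.prems(2)[of j n] that by fastforce
    have "R j k \<longleftrightarrow> ?l ! j = ?l ! k" if "j < Suc n" "k < Suc n" for j k
      using that new[of j] new'[of k] R[of j k] Suc.prems(1)[of n] len
      by (cases "j < n"; cases "k < n") (simp_all add: nth_append less_Suc_eq)
    then show ?thesis using mem by blast
  next
    case False
    let ?l = "l @ [n]"
    have mem: "?l \<in> set (growth_lists (Suc n))" by (intro growth_lists_SucI[OF l]) simp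
    have "R j k \<longleftrightarrow> ?l ! j = ?l ! k" if "j < Suc n" "k < Suc n" for j k
      using that False R[of j k] Suc.prems(1)[of n] Suc.prems(2)[of n k] bound[of j] bound[of k] len
      by (cases "j < n"; cases "k < n") (auto simp: nth_append less_Suc_eq)
    then show ?thesis using mem by blast
  qed
qed

text \<open>The membership lists of the unions of classes of the partition \<open>l\<close>.\<close>

fun class_unions :: "nat list \<Rightarrow> nat \<Rightarrow> bool list list" where
  "class_unions l 0 = [[]]"
| "class_unions l (Suc n) =
    concat (map (\<lambda>c. if l ! n = n then [c @ [False], c @ [True]] else [c @ [c ! (l ! n)]])
      (class_unions l n))"

lemma class_unions_SucI:
  assumes "c \<in> set (class_unions l n)" "l ! n = n \<or> x = c ! (l ! n)"
  shows "c @ [x] \<in> set (class_unions l (Suc n))"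
proof -
  have "c @ [x] \<in> set (if l ! n = n then [c @ [False], c @ [True]] else [c @ [c ! (l ! n)]])"
    using assms(2) by (cases x) auto
  then show ?thesis using assms(1) unfolding class_unions.simps set_concat set_map image_image by (intro UN_I[of c])
qed
lemma class_union_member:
  assumes "length l = n" "\<And>i. i < n \<Longrightarrow> l ! i \<le> i \<and> l ! (l ! i) = l ! i"
    and "length c = n" "\<And>i j. \<lbrakk>i < n; j < n; l ! i = l ! j\<rbrakk> \<Longrightarrow> c ! i = c ! j"
  shows "c \<in> set (class_unions l n)"
proof -
  have "take m c \<in> set (class_unions l m)" if "m \<le> n" for m
    using that
  proof (induction m)
    case (Suc m)
    then have IH: "take m c \<in> set (class_unions l m)" and m: "m < n" by auto
    have last: "take (Suc m) c = take m c @ [c ! m]" using m assms(3) by (simp add: take_Suc_conv_app_nth)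
    have "l ! m = m \<or> c ! m = take m c ! (l ! m)"
    proof (rule disjCI)
      assume "\<not> c ! m = take m c ! (l ! m)"
      then have "\<not> l ! m < m" using assms(2)[OF m] assms(4)[of "l ! m" m] m by fastforce
      then show "l ! m = m" using assms(2)[OF m] by simp
    qed
    then show ?case unfolding last by (intro class_unions_SucI IH)
  qed simp
  from this[of n] show ?thesis using assms(3) by simp
qed

section \<open>Search for isomorphisms\<close>

text \<open>Backtracking search for a permutation of \<open>{0..<5}\<close>. The test \<open>ok\<close> sees the next value together with
  the values chosen so far, so that wrong branches are cut as early as possible.\<close>

fun extend :: "(nat list \<Rightarrow> nat \<Rightarrow> bool) \<Rightarrow> nat \<Rightarrow> nat list \<Rightarrow> bool" where
  "extend ok 0 qs \<longleftrightarrow> True"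
| "extend ok (Suc n) qs \<longleftrightarrow>
     list_ex (\<lambda>v. v \<notin> set qs \<and> ok qs v \<and> extend ok n (qs @ [v])) [0..<5]"

lemma extend_sound:
  assumes "extend ok n qs" "distinct qs" "set qs \<subseteq> {0..<5}"
  shows "\<exists>ps. length ps = length qs + n \<and> distinct ps \<and> set ps \<subseteq> {0..<5} \<and> take (length qs) ps = qs \<and>
    (\<forall>k. length qs \<le> k \<and> k < length ps \<longrightarrow> ok (take k ps) (ps ! k))"
  using assms
proof (induction n arbitrary: qs)
  case 0
  then show ?case by (intro exI[of _ qs]) auto
next
  case (Suc n)
  then obtain v where v: "v < 5" "v \<notin> set qs" "ok qs v" "extend ok n (qs @ [v])"
    by (auto simp: list_ex_iff)
  then have "distinct (qs @ [v])" "set (qs @ [v]) \<subseteq> {0..<5}" using Suc.prems by auto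
  from Suc.IH[OF v(4) this] obtain ps where ps: "length ps = length qs + Suc n" "distinct ps"
    "set ps \<subseteq> {0..<5}" "take (Suc (length qs)) ps = qs @ [v]"
    and ok: "\<And>k. \<lbrakk>Suc (length qs) \<le> k; k < length ps\<rbrakk> \<Longrightarrow> ok (take k ps) (ps ! k)"
    by auto
  have "take (length qs) ps = take (length qs) (take (Suc (length qs)) ps)" by simp
  then have first: "take (length qs) ps = qs" using ps(4) by simp
  have "ps ! length qs = take (Suc (length qs)) ps ! length qs" by simp
  then have "ps ! length qs = v" using ps(4) by simp
  then have "ok (take k ps) (ps ! k)" if "length qs \<le> k" "k < length ps" for k
    using that ok[of k] first v(3) by (cases "k = length qs") auto
  then show ?case using ps first by blast
qed

lemma extend_permutation:
  assumes "extend ok 5 []"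
  obtains ps where "length ps = 5" "distinct ps" "set ps = {0..<5}"
    "\<And>k. k < 5 \<Longrightarrow> ok (take k ps) (ps ! k)"
proof -
  obtain ps where ps: "length ps = 5" "distinct ps" "set ps \<subseteq> {0..<5}"
    and ok: "\<And>k. k < 5 \<Longrightarrow> ok (take k ps) (ps ! k)"
    using extend_sound[OF assms] by auto
  moreover have "set ps = {0..<5}"
    using ps distinct_card[OF ps(2)] by (intro card_subset_eq) auto
  ultimately show ?thesis using that by blast
qed

definition same_partition :: "nat list \<Rightarrow> nat list \<Rightarrow> bool" where
  "same_partition a a' \<longleftrightarrow> extend (\<lambda>qs v.
     list_all (\<lambda>i. (a' ! i = a' ! length qs) = (a ! (qs ! i) = a ! v)) [0..<length qs]) 5 []"

lemma same_partition_sound: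
  assumes "same_partition a a'"
  obtains ps where "length ps = 5" "distinct ps" "set ps = {0..<5}"
    "\<And>i j. \<lbrakk>i < 5; j < 5\<rbrakk> \<Longrightarrow> (a' ! i = a' ! j) = (a ! (ps ! i) = a ! (ps ! j))"
proof -
  obtain ps where ps: "length ps = 5" "distinct ps" "set ps = {0..<5}"
    and ok: "\<And>k. k < 5 \<Longrightarrow> list_all (\<lambda>i. (a' ! i = a' ! length (take k ps)) =
        (a ! (take k ps ! i) = a ! (ps ! k))) [0..<length (take k ps)]"
    using extend_permutation[OF assms[unfolded same_partition_def]] by blast
  have less: "(a' ! i = a' ! k) = (a ! (ps ! i) = a ! (ps ! k))" if "i < k" "k < 5" for i k
    using ok[OF \<open>k < 5\<close>] that ps(1) by (auto simp: list_all_iff)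
  have "(a' ! i = a' ! j) = (a ! (ps ! i) = a ! (ps ! j))" if "i < 5" "j < 5" for i j
    using less[of i j] less[of j i] that by (cases i j rule: linorder_cases) auto
  then show ?thesis using that ps by blast
qed

text \<open>One partition of five elements for each nontrivial list of block sizes. Vertices will be numbered such that
  the \<open>z\<close>-cliques have this form.\<close>

definition canonical :: "nat list list" where
  "canonical = [[0,0,2,3,4], [0,0,2,2,4], [0,0,0,3,4], [0,0,0,3,3], [0,0,0,0,4], [0,0,0,0,0]]"

definition nontrivial_lists :: "nat list list" where
  "nontrivial_lists = filter (\<lambda>l. l \<noteq> [0..<5]) (growth_lists 5)"

lemma canonical_growth: "list_all (\<lambda>a. a \<in> set (growth_lists 5)) canonical"
  by code_simp

lemma partitions_canonical: "list_all (\<lambda>a. list_ex (same_partition a) canonical) nontrivial_lists"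
  by code_simp

datatype pattern = Pattern (z_labels: "nat list") (w_labels: "nat list")
  (z_marks: "bool list") (w_marks: "bool list")

primrec swap_colors :: "pattern \<Rightarrow> pattern" where
  "swap_colors (Pattern a b c d) = Pattern b a d c"

text \<open>The search sends the vertex \<open>k\<close> of the second pattern to the vertex \<open>v\<close> of the first one.\<close>

fun same_at :: "pattern \<Rightarrow> pattern \<Rightarrow> nat list \<Rightarrow> nat \<Rightarrow> bool" where
  "same_at (Pattern a b c d) (Pattern a' b' c' d') qs v \<longleftrightarrow>
     (let k = length qs in (c' ! k \<longleftrightarrow> c ! v) \<and> (d' ! k \<longleftrightarrow> d ! v) \<and>
       list_all (\<lambda>i. (a' ! i = a' ! k) = (a ! (qs ! i) = a ! v) \<and>
                     (b' ! i = b' ! k) = (b ! (qs ! i) = b ! v)) [0..<k])"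

text \<open>This necessary condition spares most searches.\<close>

definition same_count :: "pattern \<Rightarrow> pattern \<Rightarrow> bool" where
  "same_count P Q \<longleftrightarrow> length (filter id (z_marks P)) = length (filter id (z_marks Q)) \<and>
      length (filter id (w_marks P)) = length (filter id (w_marks Q))"

definition isomorphic where
  "isomorphic P Q \<longleftrightarrow> same_count P Q \<and> extend (same_at P Q) 5 []"

lemma isomorphic_sound:
  assumes "isomorphic (Pattern a b c d) (Pattern a' b' c' d')"
  obtains ps where "length ps = 5" "distinct ps" "set ps = {0..<5}"
    "\<And>i j. \<lbrakk>i < 5; j < 5\<rbrakk> \<Longrightarrow> (a' ! i = a' ! j) = (a ! (ps ! i) = a ! (ps ! j))"
    "\<And>i j. \<lbrakk>i < 5; j < 5\<rbrakk> \<Longrightarrow> (b' ! i = b' ! j) = (b ! (ps ! i) = b ! (ps ! j))"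
    "\<And>i. i < 5 \<Longrightarrow> c' ! i = c ! (ps ! i)" "\<And>i. i < 5 \<Longrightarrow> d' ! i = d ! (ps ! i)"
proof -
  have "extend (same_at (Pattern a b c d) (Pattern a' b' c' d')) 5 []"
    using assms by (simp add: isomorphic_def)
  then obtain ps where ps: "length ps = 5" "distinct ps" "set ps = {0..<5}"
    and ok: "\<And>k. k < 5 \<Longrightarrow> same_at (Pattern a b c d) (Pattern a' b' c' d') (take k ps) (ps ! k)"
    using extend_permutation by blast
  have less: "(a' ! i = a' ! k) = (a ! (ps ! i) = a ! (ps ! k)) \<and>
      (b' ! i = b' ! k) = (b ! (ps ! i) = b ! (ps ! k))" if "i < k" "k < 5" for i k
    using ok[OF \<open>k < 5\<close>] that ps(1) by (auto simp: list_all_iff Let_def)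
  have "(a' ! i = a' ! j) = (a ! (ps ! i) = a ! (ps ! j))"
    "(b' ! i = b' ! j) = (b ! (ps ! i) = b ! (ps ! j))" if "i < 5" "j < 5" for i j
    using less[of i j] less[of j i] that by (cases i j rule: linorder_cases; auto)+
  moreover have "c' ! i = c ! (ps ! i)" "d' ! i = d ! (ps ! i)" if "i < 5" for i
    using ok[OF that] that ps(1) by (auto simp: Let_def)
  ultimately show ?thesis using that ps by blast
qed

section \<open>The finite verification\<close>

abbreviation (input) "T \<equiv> True"
abbreviation (input) "F \<equiv> False"
text \<open>The thirty-one diagrams, in the order of \<open>five_vortex_diagrams\<close>; the vertices \<open>1, \<dots>, 5\<close> have
  become \<open>0, \<dots>, 4\<close>.\<close>

definition patterns :: "pattern list" where
  "patterns = [
     Pattern [0,0,2,3,4] [0,1,2,2,4] [T,T,F,F,F] [F,F,T,T,F],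
     Pattern [0,0,2,3,4] [0,1,2,2,2] [T,T,F,F,F] [F,F,F,F,F],
     Pattern [0,0,2,3,4] [0,1,2,2,2] [T,T,F,F,F] [F,F,T,T,F],
     Pattern [0,0,2,3,4] [0,1,2,2,2] [T,T,F,F,F] [F,F,T,T,T],
     Pattern [0,0,2,2,4] [0,1,1,0,4] [T,T,T,T,F] [T,T,T,T,F],
     Pattern [0,0,0,3,4] [0,0,0,3,4] [F,F,F,F,F] [F,F,F,F,F],
     Pattern [0,0,0,3,3] [0,0,0,3,4] [F,F,F,T,T] [F,F,F,F,F],
     Pattern [0,0,0,3,3] [0,0,0,3,3] [T,T,T,T,T] [T,T,T,T,T],
     Pattern [0,1,0,0,4] [0,0,2,0,4] [F,F,F,F,F] [F,F,F,F,F],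
     Pattern [0,1,0,0,1] [0,0,2,0,4] [T,T,T,T,T] [F,F,F,F,F],
     Pattern [0,1,0,0,1] [0,0,2,0,2] [T,T,T,T,T] [T,T,T,T,T],
     Pattern [0,1,2,0,0] [0,0,0,3,4] [F,F,F,F,F] [F,F,F,F,F],
     Pattern [0,1,2,0,0] [0,0,0,3,4] [F,F,F,F,F] [F,T,T,F,F],
     Pattern [0,1,2,0,0] [0,0,0,3,4] [F,F,F,T,T] [F,T,T,F,F],
     Pattern [0,1,1,0,0] [0,0,0,3,3] [T,T,T,T,T] [T,T,T,T,T],
     Pattern [0,0,0,0,4] [0,0,0,3,4] [T,T,T,T,F] [F,F,F,F,F],
     Pattern [0,0,0,0,4] [0,0,0,3,3] [T,T,T,F,F] [T,T,T,T,T],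
     Pattern [0,1,0,3,0] [0,0,0,0,4] [F,F,F,F,F] [F,F,F,F,F],
     Pattern [0,1,0,3,0] [0,0,0,0,4] [F,F,F,F,F] [F,T,F,T,F],
     Pattern [0,1,0,1,0] [0,0,0,0,4] [T,T,T,T,T] [F,F,F,F,F],
     Pattern [0,0,0,0,4] [0,0,0,0,4] [F,F,F,F,F] [F,F,F,F,F],
     Pattern [0,0,0,0,0] [0,0,0,3,4] [T,T,T,T,F] [F,F,F,F,F],
     Pattern [0,0,0,0,0] [0,0,0,3,4] [T,T,T,T,T] [F,F,F,F,F],
     Pattern [0,0,0,0,0] [0,0,0,3,4] [F,F,F,F,F] [F,F,F,F,F],
     Pattern [0,0,0,0,0] [0,0,0,3,4] [F,F,F,T,T] [F,F,F,F,F],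
     Pattern [0,0,0,0,0] [0,0,0,3,3] [T,T,T,F,F] [T,T,T,T,T],
     Pattern [0,0,0,0,0] [0,0,0,3,3] [T,T,T,T,T] [T,T,T,T,T],
     Pattern [0,0,0,0,4] [0,0,0,3,0] [F,F,F,F,F] [F,F,F,F,F],
     Pattern [0,0,0,0,0] [0,0,0,0,4] [T,T,T,T,T] [F,F,F,F,F],
     Pattern [0,0,0,0,0] [0,0,0,0,0] [F,F,F,F,F] [F,F,F,F,F],
     Pattern [0,0,0,0,0] [0,0,0,0,0] [T,T,T,T,T] [T,T,T,T,T]]"

definition same_label :: "nat list \<Rightarrow> nat \<Rightarrow> nat \<Rightarrow> bool" where
  "same_label l i j \<longleftrightarrow> l ! i = l ! j"

definition candidates :: "nat list \<Rightarrow> nat list \<Rightarrow> bool list list" where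
  "candidates a b = filter (\<lambda>c. circle_rules (set [0..<5]) (same_label a) ((!) c)) (class_unions b 5)"

text \<open>For fixed partitions, the circles of each colour range over the unions of cliques of the other
  colour.\<close>

definition all_listed :: "nat list \<Rightarrow> nat list \<Rightarrow> bool" where
  "all_listed a b \<longleftrightarrow> list_all (\<lambda>c. list_all (\<lambda>d.
     vorticity_rules (set [0..<5]) (same_label a) (same_label b) ((!) c) ((!) d) \<and>
     vorticity_rules (set [0..<5]) (same_label b) (same_label a) ((!) d) ((!) c) \<longrightarrow>
     list_ex (isomorphic (Pattern a b c d)) (patterns @ map swap_colors patterns))
     (candidates b a)) (candidates a b)"

lemma listed_pair: "list_all (all_listed [0,0,2,3,4]) nontrivial_lists"
  by code_simp

lemma listed_two_pairs: "list_all (all_listed [0,0,2,2,4]) nontrivial_lists"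
  by code_simp

lemma listed_triangle: "list_all (all_listed [0,0,0,3,4]) nontrivial_lists"
  by code_simp

lemma listed_triangle_and_pair: "list_all (all_listed [0,0,0,3,3]) nontrivial_lists"
  by code_simp

lemma listed_quadruple: "list_all (all_listed [0,0,0,0,4]) nontrivial_lists"
  by code_simp

lemma listed_all_five: "list_all (all_listed [0,0,0,0,0]) nontrivial_lists"
  by code_simp

definition label_strokes :: "nat list \<Rightarrow> nat set set" where
  "label_strokes l = (\<Union>j\<in>{0..<5}. (\<lambda>i. {Suc i, Suc j}) ` {i \<in> {0..<j}. l ! i = l ! j})"

definition marked :: "bool list \<Rightarrow> nat set" where
  "marked c = {Suc i | i. i < 5 \<and> c ! i}"

primrec pattern_diagram :: "pattern \<Rightarrow> diagram" where
  "pattern_diagram (Pattern a b c d) = Diagram (label_strokes a) (label_strokes b) (marked c) (marked d)"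

lemma pattern_diagram_swap: "pattern_diagram (swap_colors P) = exchange_colors (pattern_diagram P)"
  by (cases P) simp

text \<open>Executable forms of the set comprehensions, for comparing the encoded patterns with the listed
  diagrams by rewriting.\<close>

lemma label_strokes_code [code]:
  "label_strokes l = set (concat (map (\<lambda>j. map (\<lambda>i. {Suc i, Suc j})
     (filter (\<lambda>i. l ! i = l ! j) [0..<j])) [0..<5]))"
  unfolding label_strokes_def by (simp only: set_concat set_map set_filter set_upt image_image)

lemma marked_code [code]: "marked c = Suc ` set (filter ((!) c) [0..<5])"
  unfolding marked_def set_filter set_upt by auto

lemma K_code [code]:
  "K (set xs) = set (concat (map (\<lambda>i. map (\<lambda>j. {i, j}) (filter (\<lambda>j. i \<noteq> j) xs)) xs))"
  unfolding K_def set_concat set_map set_filter image_image by auto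

lemma patterns_diagrams: "map pattern_diagram patterns = five_vortex_diagrams"
  by code_simp

section \<open>Classification\<close>

text \<open>The rules are invariant under renaming the vertices. They are transferred from the vertices of the
  vortex system to the numbers \<open>0, \<dots>, 4\<close> of an enumeration.\<close>

lemma circle_rules_transfer:
  assumes "inj_on f I" "\<And>i j. \<lbrakk>i \<in> I; j \<in> I\<rbrakk> \<Longrightarrow> R (f i) (f j) \<longleftrightarrow> R' i j" "\<And>i. i \<in> I \<Longrightarrow> C (f i) \<longleftrightarrow> C' i"
    and "circle_rules (f ` I) R C"
  shows "circle_rules I R' C'"
  using assms unfolding circle_rules_def by (simp add: inj_on_eq_iff cong: ball_cong bex_cong)

lemma vorticity_rules_transfer:
  assumes "inj_on f I" "\<And>i j. \<lbrakk>i \<in> I; j \<in> I\<rbrakk> \<Longrightarrow> R (f i) (f j) \<longleftrightarrow> R' i j"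
    "\<And>i j. \<lbrakk>i \<in> I; j \<in> I\<rbrakk> \<Longrightarrow> S (f i) (f j) \<longleftrightarrow> S' i j"
    "\<And>i. i \<in> I \<Longrightarrow> C (f i) \<longleftrightarrow> C' i" "\<And>i. i \<in> I \<Longrightarrow> D (f i) \<longleftrightarrow> D' i"
    and "vorticity_rules (f ` I) R S C D"
  shows "vorticity_rules I R' S' C' D'"
  using assms unfolding vorticity_rules_def vanishing_def by (simp add: inj_on_eq_iff cong: ball_cong bex_cong)

text \<open>If an enumeration \<open>us\<close> of the vertices turns the relation \<open>R\<close> into the partition \<open>l\<close>, then the strokes
  of \<open>R\<close> arise from those of \<open>l\<close> by the relabelling \<open>i + 1 \<mapsto> us ! i\<close>.\<close>

lemma relabelled_strokes:
  fixes us :: "nat list" and p :: "nat \<Rightarrow> nat"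
  assumes us: "length us = 5" "distinct us" "set us = {1..5}"
    and R: "\<And>i j. \<lbrakk>i < 5; j < 5\<rbrakk> \<Longrightarrow> R (us ! i) (us ! j) \<longleftrightarrow> l ! i = l ! j"
    and p: "\<And>i. i < 5 \<Longrightarrow> p (Suc i) = us ! i"
  shows "{{j, k} | j k. 1 \<le> j \<and> j < k \<and> k \<le> 5 \<and> R j k} = (`) p ` label_strokes l"
proof (intro equalityI subsetI)
  fix e assume "e \<in> {{j, k} | j k. 1 \<le> j \<and> j < k \<and> k \<le> 5 \<and> R j k}"
  then obtain j k where e: "e = {j, k}" "1 \<le> j" "j < k" "k \<le> 5" "R j k" by auto
  then have "j \<in> set us" "k \<in> set us" using us(3) by auto
  then obtain i m where im: "i < 5" "m < 5" "j = us ! i" "k = us ! m" using us(1) by (metis in_set_conv_nth)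
  then have lab: "l ! i = l ! m" "i \<noteq> m" using R e(3,5) by auto
  have "e = p ` {Suc i, Suc m}" using e im p by simp
  moreover have "{Suc i, Suc m} \<in> label_strokes l"
  proof (cases "i < m")
    case True
    then show ?thesis unfolding label_strokes_def
      by (intro UN_I[of m] image_eqI[of _ _ i]) (use im lab in auto)
  next
    case False
    then show ?thesis unfolding label_strokes_def
      by (intro UN_I[of i] image_eqI[of _ _ m]) (use im lab in auto)
  qed
  ultimately show "e \<in> (`) p ` label_strokes l" by (rule image_eqI)
next
  fix e assume "e \<in> (`) p ` label_strokes l"
  then obtain i m where im: "e = {p (Suc i), p (Suc m)}" "i < m" "m < 5" "l ! i = l ! m"
    by (auto simp: label_strokes_def)
  then have e: "e = {us ! i, us ! m}" using p by simp
  have "us ! i \<noteq> us ! m" "us ! i \<in> {1..5}" "us ! m \<in> {1..5}"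
    using im us by (auto simp: nth_eq_iff_index_eq us(3)[symmetric])
  moreover have "R (us ! i) (us ! m)" "R (us ! m) (us ! i)" using R im by auto
  ultimately have "\<exists>j k. {us ! i, us ! m} = {j, k} \<and> 1 \<le> j \<and> j < k \<and> k \<le> 5 \<and> R j k"
  proof (cases "us ! i < us ! m")
    case False
    then show ?thesis
      by (intro exI[of _ "us ! m"] exI[of _ "us ! i"])
        (use \<open>us ! i \<noteq> us ! m\<close> \<open>us ! i \<in> {1..5}\<close> \<open>us ! m \<in> {1..5}\<close> \<open>R (us ! m) (us ! i)\<close> in auto)
  qed auto
  then show "e \<in> {{j, k} | j k. 1 \<le> j \<and> j < k \<and> k \<le> 5 \<and> R j k}" unfolding e by blast
qed

lemma relabelled_marks:
  fixes us :: "nat list" and p :: "nat \<Rightarrow> nat"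
  assumes us: "length us = 5" "set us = {1..5}"
    and C: "\<And>i. i < 5 \<Longrightarrow> C (us ! i) \<longleftrightarrow> c ! i"
    and p: "\<And>i. i < 5 \<Longrightarrow> p (Suc i) = us ! i"
  shows "{k \<in> {1..5}. C k} = p ` marked c"
proof -
  have "{k \<in> set us. C k} = p ` marked c"
    using C p us(1) by (force simp: marked_def in_set_conv_nth)
  then show ?thesis using us(2) by simp
qed

theorem mainTheorem1:
  fixes \<Gamma> :: "nat \<Rightarrow> real" and \<Lambda> :: complex
    and X Y :: "nat \<Rightarrow> cvector"
  assumes "\<forall>k\<in>{1..5}. \<Gamma> k \<noteq> 0"
    and "cmod \<Lambda> = 1"
    and "singular_sequence 5 \<Gamma> \<Lambda> X Y"
  shows "\<exists>D \<in> set five_vortex_diagrams. equivalent_diagrams 5 (diagram_of 5 X Y) D"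
proof -
  interpret singular_limits 5 \<Gamma> \<Lambda> X Y by standard (use assms in auto)
  interpret swap: singular_limits 5 \<Gamma> "cnj \<Lambda>" Y X by (rule exchanged)
  let ?R = "same_clique 5 X" and ?S = "same_clique 5 Y"
  let ?C = "\<lambda>k. \<zeta> k \<noteq> 0" and ?D = "\<lambda>k. \<omega> k \<noteq> 0"
  have labels: "\<exists>l \<in> set nontrivial_lists. \<forall>i<5. \<forall>j<5. same_clique 5 U (us ! i) (us ! j) \<longleftrightarrow> l ! i = l ! j"
    if us: "length us = 5" "distinct us" "set us = {1..5}" and "U = X \<or> U = Y" for us U
  proof -
    have range: "us ! i \<in> {1..5}" if "i < 5" for i using us that nth_mem by metis
    have "\<exists>l \<in> set (growth_lists 5). \<forall>i<5. \<forall>j<5. same_clique 5 U (us ! i) (us ! j) \<longleftrightarrow> l ! i = l ! j"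
    proof (rule growth_list_of_equivalence)
      fix i j k :: nat assume ijk: "i < 5" "j < 5" "k < 5"
        "same_clique 5 U (us ! i) (us ! j)" "same_clique 5 U (us ! j) (us ! k)"
      show "same_clique 5 U (us ! i) (us ! k)"
        using \<open>U = X \<or> U = Y\<close> ijk(4,5) same_clique_trans[OF ijk(1-3)[THEN range]]
          swap.same_clique_trans[OF ijk(1-3)[THEN range]] by blast
    next
      fix i j :: nat assume ij: "i < 5" "j < 5" "same_clique 5 U (us ! i) (us ! j)"
      show "same_clique 5 U (us ! j) (us ! i)"
        using \<open>U = X \<or> U = Y\<close> ij(3) same_clique_sym[OF ij(1,2)[THEN range]]
          swap.same_clique_sym[OF ij(1,2)[THEN range]] by blast
    qed (simp add: same_clique_def)
    then obtain l where l: "l \<in> set (growth_lists 5)"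
      and lab: "\<And>i j. \<lbrakk>i < 5; j < 5\<rbrakk> \<Longrightarrow> same_clique 5 U (us ! i) (us ! j) \<longleftrightarrow> l ! i = l ! j" by blast
    obtain j k where "j \<in> set us" "k \<in> set us" "j \<noteq> k" "same_clique 5 U j k"
      using some_stroke swap.some_stroke \<open>U = X \<or> U = Y\<close> us(3) by metis
    then obtain i m where "i < 5" "m < 5" "i \<noteq> m" "same_clique 5 U (us ! i) (us ! m)"
      using us(1) by (metis in_set_conv_nth)
    then have "l \<noteq> [0..<5]" using lab by fastforce
    then show ?thesis using l lab by (auto simp: nontrivial_lists_def)
  qed
  obtain a0 where a0: "a0 \<in> set nontrivial_lists"
    "\<And>i j. \<lbrakk>i < 5; j < 5\<rbrakk> \<Longrightarrow> ?R ([1..<6] ! i) ([1..<6] ! j) \<longleftrightarrow> a0 ! i = a0 ! j"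
    using labels[of "[1..<6]" X] by (auto simp: atLeastLessThanSuc_atLeastAtMost[symmetric])
  obtain a where a: "a \<in> set canonical" "same_partition a0 a"
    using partitions_canonical a0(1) by (auto simp: list_all_iff list_ex_iff)
  obtain ps where ps: "length ps = 5" "distinct ps" "set ps = {0..<5}"
    "\<And>i j. \<lbrakk>i < 5; j < 5\<rbrakk> \<Longrightarrow> (a ! i = a ! j) = (a0 ! (ps ! i) = a0 ! (ps ! j))"
    using same_partition_sound[OF a(2)] by blast
  \<comment> \<open>renumber the vertices so that the \<open>z\<close>-cliques are in normal form\<close>
  define us where "us = map Suc ps"
  have us: "length us = 5" "distinct us" "set us = {1..5}"
    using ps by (auto simp: us_def distinct_map image_Suc_atLeastLessThan atLeastLessThanSuc_atLeastAtMost)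
  have psi: "ps ! i < 5" if "i < 5" for i using ps that nth_mem by fastforce
  have aR: "?R (us ! i) (us ! j) \<longleftrightarrow> a ! i = a ! j" if "i < 5" "j < 5" for i j
    using a0(2)[OF psi psi, OF that] ps(1) ps(4)[OF that] psi that by (simp add: us_def)
  obtain b where b: "b \<in> set nontrivial_lists"
    "\<And>i j. \<lbrakk>i < 5; j < 5\<rbrakk> \<Longrightarrow> ?S (us ! i) (us ! j) \<longleftrightarrow> b ! i = b ! j"
    using labels[OF us, of Y] by blast
  define c where "c = map (\<lambda>i. ?C (us ! i)) [0..<5]"
  define d where "d = map (\<lambda>i. ?D (us ! i)) [0..<5]"
  have cd: "c ! i \<longleftrightarrow> ?C (us ! i)" "d ! i \<longleftrightarrow> ?D (us ! i)" if "i < 5" for i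
    using that by (simp_all add: c_def d_def)
  have usV: "us ! i \<in> V" if "i < 5" for i using us that nth_mem by metis
  have image: "V = (!) us ` set [0..<5]"
    using nth_image[of 5 us] us by simp
  have inj: "inj_on ((!) us) (set [0..<5])" using us by (auto simp: inj_on_def nth_eq_iff_index_eq)
  have "a \<in> set (growth_lists 5)" using canonical_growth a(1) by (simp add: list_all_iff)
  have c: "c \<in> set (candidates a b)"
  proof -
    have "c \<in> set (class_unions b 5)"
    proof (rule class_union_member)
      show "c ! i = c ! j" if "i < 5" "j < 5" "b ! i = b ! j" for i j
        using swap.same_clique_opposite_position[OF usV[OF that(1)] usV[OF that(2)]] that b(2) cd by simp
    qed (use b(1) growth_lists_properties[of b 5] in \<open>auto simp: nontrivial_lists_def c_def\<close>)
    moreover have "circle_rules (set [0..<5]) (same_label a) ((!) c)"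
      by (rule circle_rules_transfer[OF inj _ _ circle_rules[unfolded image]])
        (simp_all add: aR cd same_label_def)
    ultimately show ?thesis by (simp add: candidates_def)
  qed
  have d: "d \<in> set (candidates b a)"
  proof -
    have "d \<in> set (class_unions a 5)"
    proof (rule class_union_member)
      show "d ! i = d ! j" if "i < 5" "j < 5" "a ! i = a ! j" for i j
        using same_clique_opposite_position[OF usV[OF that(1)] usV[OF that(2)]] that aR cd by simp
    qed (use \<open>a \<in> set (growth_lists 5)\<close> growth_lists_properties[of a 5] in \<open>auto simp: d_def\<close>)
    moreover have "circle_rules (set [0..<5]) (same_label b) ((!) d)"
      by (rule circle_rules_transfer[OF inj _ _ swap.circle_rules[unfolded image]])
        (simp_all add: b(2) cd same_label_def)
    ultimately show ?thesis by (simp add: candidates_def)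
  qed
  have "vorticity_rules (set [0..<5]) (same_label a) (same_label b) ((!) c) ((!) d)"
    by (rule vorticity_rules_transfer[OF inj _ _ _ _ vorticity_rules[unfolded image]])
      (simp_all add: aR b(2) cd same_label_def)
  moreover have "vorticity_rules (set [0..<5]) (same_label b) (same_label a) ((!) d) ((!) c)"
    by (rule vorticity_rules_transfer[OF inj _ _ _ _ swap.vorticity_rules[unfolded image]])
      (simp_all add: aR b(2) cd same_label_def)
  moreover have "all_listed a b"
    using a(1) b(1) listed_pair listed_two_pairs listed_triangle listed_triangle_and_pair
      listed_quadruple listed_all_five
    by (auto simp: canonical_def list_all_iff)
  ultimately have "list_ex (isomorphic (Pattern a b c d)) (patterns @ map swap_colors patterns)"
    using c d unfolding all_listed_def list_all_iff by blast
  then obtain Q where Q: "Q \<in> set (patterns @ map swap_colors patterns)"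
    "isomorphic (Pattern a b c d) Q" unfolding list_ex_iff by blast
  obtain a' b' c' d' where Q': "Q = Pattern a' b' c' d'" by (cases Q)
  obtain qs where qs: "length qs = 5" "distinct qs" "set qs = {0..<5}"
    "\<And>i j. \<lbrakk>i < 5; j < 5\<rbrakk> \<Longrightarrow> (a' ! i = a' ! j) = (a ! (qs ! i) = a ! (qs ! j))"
    "\<And>i j. \<lbrakk>i < 5; j < 5\<rbrakk> \<Longrightarrow> (b' ! i = b' ! j) = (b ! (qs ! i) = b ! (qs ! j))"
    "\<And>i. i < 5 \<Longrightarrow> c' ! i = c ! (qs ! i)" "\<And>i. i < 5 \<Longrightarrow> d' ! i = d ! (qs ! i)"
    using isomorphic_sound[OF Q(2)[unfolded Q']] by blast
  \<comment> \<open>the enumeration in which the diagram looks exactly like \<open>Q\<close>\<close>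
  define ws where "ws = map ((!) us) qs"
  have qsi: "qs ! i < 5" if "i < 5" for i using qs that nth_mem by fastforce
  have ws: "length ws = 5" "distinct ws" "set ws = {1..5}"
    using qs us inj image by (simp_all add: ws_def distinct_map)
  define p where "p i = (if i \<in> {1..5} then ws ! (i - 1) else i)" for i
  have p: "p (Suc i) = ws ! i" if "i < 5" for i using that by (simp add: p_def)
  have "p permutes {1..5}"
  proof (rule bij_imp_permutes)
    have "inj_on p {1..5}"
    proof (rule inj_onI)
      fix x y assume xy: "x \<in> {1..5}" "y \<in> {1..5}" "p x = p y"
      then have "ws ! (x - 1) = ws ! (y - 1)" by (simp add: p_def)
      then have "x - 1 = y - 1" using xy ws(1,2) by (subst (asm) nth_eq_iff_index_eq) auto
      then show "x = y" using xy by auto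
    qed
    moreover have "p x \<in> {1..5}" if "x \<in> {1..5}" for x
    proof -
      have "ws ! (x - 1) \<in> set ws" using that ws(1) by (intro nth_mem) auto
      then show ?thesis using that ws(3) by (simp add: p_def)
    qed
    then have "p ` {1..5} \<subseteq> {1..5}" by blast
    ultimately show "bij_betw p {1..5} {1..5}" by (simp add: bij_betw_def endo_inj_surj)
    show "p x = x" if "x \<notin> {1..5}" for x using that by (auto simp: p_def)
  qed
  have wsi: "ws ! i = us ! (qs ! i)" if "i < 5" for i using that qs(1) by (simp add: ws_def)
  have "?R (ws ! i) (ws ! j) \<longleftrightarrow> a' ! i = a' ! j" "?S (ws ! i) (ws ! j) \<longleftrightarrow> b' ! i = b' ! j"
    if "i < 5" "j < 5" for i j
    using that aR[OF qsi qsi] b(2)[OF qsi qsi] qs(4,5) by (simp_all add: wsi)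
  moreover have "?C (ws ! i) \<longleftrightarrow> c' ! i" "?D (ws ! i) \<longleftrightarrow> d' ! i" if "i < 5" for i
    using that cd[OF qsi] qs(6,7) by (simp_all add: wsi)
  ultimately have "diagram_of 5 X Y = relabel p (pattern_diagram Q)"
    unfolding diagram_eq Q' pattern_diagram.simps relabel.simps diagram.inject
    by (intro conjI relabelled_strokes[OF ws _ p] relabelled_marks[OF ws(1,3) _ p])
  then show ?thesis
    using Q(1) \<open>p permutes {1..5}\<close> pattern_diagram_swap
    unfolding equivalent_diagrams_def patterns_diagrams[symmetric]
    by (auto 0 4)
qed
end
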